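(* Let $K$ be any quadratic field and let $E$ be the elliptic curve $y^2 = x^3 + 1$. Then the torsion subgroup $E(K)_{tors}$ of the group $E(K)$ of $K$-rational points of $E$ is isomorphic to one of $\mathbb{Z}/6\mathbb{Z}$, $\mathbb{Z}/18\mathbb{Z}$, or $\mathbb{Z}/2\mathbb{Z} \oplus \mathbb{Z}/6\mathbb{Z}$.
   Context: A quadratic field is a field extension of $\mathbb{Q}$ of degree $2$. $E(K)$ consists of the affine points $(x,y) \in K^2$ satisfying the equation together with the point at infinity $\mathcal{O}$, which is the identity of the group law. *)

theory Defs
  imports Complex_Main "HOL-Algebra.Elementary_Groups"
begin

text \<open>
  Fields are types of class \<open>field_char_0\<close>, which are exactly the field extensions of the
  rationals, via \<^const>\<open>of_rat\<close>. The dimension function \<open>vector_space.dim\<close> is \<open>0\<close> for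
  infinite-dimensional spaces, so the value \<open>2\<close> really expresses degree 2.
\<close>

lemma vector_space_of_rat:
  "vector_space (\<lambda>(q::rat) (x::'a::field_char_0). of_rat q * x)"
  by unfold_locales (simp_all add: algebra_simps of_rat_add of_rat_mult)

definition quadratic_field :: "'a::field_char_0 itself \<Rightarrow> bool" where
  "quadratic_field _ \<longleftrightarrow>
     vector_space.dim (\<lambda>(q::rat) (x::'a). of_rat q * x) (UNIV :: 'a set) = 2"

datatype 'a ec_point = Infinity | Affine 'a 'a

definition ec_points :: "'a::field \<Rightarrow> 'a \<Rightarrow> 'a ec_point set" where
  "ec_points a b = {Infinity} \<union> {Affine x y | x y. y ^ 2 = x ^ 3 + a * x + b}"

text \<open>
  The chord-tangent law on \<open>y\<^sup>2 = x\<^sup>3 + a x + b\<close>. For two points of the curve with equal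
  \<open>x\<close>-coordinates, failure of \<open>y1 = - y2\<close> forces \<open>y1 = y2 \<noteq> 0\<close>, so the slope of the tangent
  is then well defined.
\<close>

fun ec_add :: "'a::field \<Rightarrow> 'a ec_point \<Rightarrow> 'a ec_point \<Rightarrow> 'a ec_point" where
  "ec_add a Infinity Q = Q"
| "ec_add a P Infinity = P"
| "ec_add a (Affine x1 y1) (Affine x2 y2) =
     (if x1 = x2 \<and> y1 = - y2 then Infinity
      else
        let m = (if x1 = x2 then (3 * x1 ^ 2 + a) / (2 * y1) else (y2 - y1) / (x2 - x1));
            x3 = m ^ 2 - x1 - x2
        in Affine x3 (m * (x1 - x3) - y1))"

definition ec_group :: "'a::field \<Rightarrow> 'a \<Rightarrow> 'a ec_point monoid" where
  "ec_group a b = \<lparr>carrier = ec_points a b, monoid.mult = ec_add a, one = Infinity\<rparr>"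

definition torsion_elements :: "('a, 'b) monoid_scheme \<Rightarrow> 'a set" where
  "torsion_elements G = {x \<in> carrier G. \<exists>n::nat. n > 0 \<and> x [^]\<^bsub>G\<^esub> n = \<one>\<^bsub>G\<^esub>}"

definition torsion_subgroup :: "('a, 'b) monoid_scheme \<Rightarrow> ('a, 'b) monoid_scheme" where
  "torsion_subgroup G = G\<lparr>carrier := torsion_elements G\<rparr>"

end

theory Submission
  imports Defs "HOL-Computational_Algebra.Polynomial" "HOL-Library.Set_Algebras"
begin

text \<open>
  Associativity: a point \<open>(u, v)\<close> is encoded by the ideal \<open>(X - u, Y - v)\<close> of the coordinate ring.
  The line through two points shows that the ideal class of a sum is the product of the classes,
  and distinct points have distinct classes because an element whose norm has degree at most 2 is
  a polynomial in \<open>X\<close>.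

  Torsion: on \<open>x\<close>-coordinates, doubling is \<open>x (x\<^sup>3 - 8) / (4 (x\<^sup>3 + 1))\<close>, which increases every
  rational height that is at least 4. So a torsion point over any field of characteristic 0 whose
  \<open>x\<close>-coordinate is rational has \<open>x \<in> {-1, 0, 2}\<close> and is a multiple of \<open>A = (2, 3)\<close>, a point of
  order 6. If \<open>P\<close> is torsion over the quadratic field \<open>K\<close> with conjugation \<open>\<sigma>\<close>, this applies to
  \<open>P + \<sigma> P\<close> and to \<open>P - \<sigma> P\<close>, so \<open>2 P\<close> is a multiple of \<open>A\<close>. It is an even one, because halving
  \<open>3 A = (-1, 0)\<close> leads to \<open>m\<^sup>4 + 6 m\<^sup>2 - 3 = 0\<close> for the slope \<open>m\<close> of the tangent, and this has no root
  in \<open>K\<close>. Hence \<open>P\<close> is a multiple of \<open>A\<close> plus a 2-torsion point. (\<open>\<int>/18\<close> does not occur.)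
\<close>

section \<open>Ideal classes\<close>

text \<open>
  Interpreting \<^locale>\<open>module\<close> with multiplication as scaling would declare left-nested
  association as a simp rule, which loops with \<open>algebra_simps\<close>; hence the explicit instances.
\<close>

lemma module_mult: "module ((*) :: 'r::comm_ring_1 \<Rightarrow> 'r \<Rightarrow> 'r)"
  by unfold_locales (simp_all add: algebra_simps)

abbreviation ideal_span :: "'r::comm_ring_1 set \<Rightarrow> 'r set" where
  "ideal_span \<equiv> module.span (*)"

lemmas ideal_span_zero = module.span_zero[OF module_mult]
  and ideal_span_base = module.span_base[OF module_mult]
  and ideal_span_add = module.span_add[OF module_mult]
  and ideal_span_diff = module.span_diff[OF module_mult]
  and ideal_span_scale = module.span_scale[OF module_mult]
  and ideal_span_eq = module.span_eq[OF module_mult]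
  and ideal_span_singleton = module.span_singleton[OF module_mult]
  and ideal_span_induct_alt = module.span_induct_alt[OF module_mult, consumes 1, case_names base step]

section \<open>Products of ideals and ideal classes\<close>

lemma span_times_mono:
  fixes S S' T :: "'r::comm_ring_1 set"
  assumes "S \<subseteq> ideal_span S'"
  shows "S * T \<subseteq> ideal_span (S' * T)"
proof
  fix z assume "z \<in> S * T"
  then obtain s t where z: "z = s * t" and s: "s \<in> S" and t: "t \<in> T"
    by (elim set_times_elim)
  from s assms have "s \<in> ideal_span S'" by blast
  then have "s * t \<in> ideal_span (S' * T)"
  proof (induction rule: ideal_span_induct_alt)
    case base
    show ?case by (simp add: ideal_span_zero)
  next
    case (step c a b)
    have "a * t \<in> ideal_span (S' * T)"
      using step.hyps t by (intro ideal_span_base set_times_intro)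
    then have "c * (a * t) \<in> ideal_span (S' * T)"
      by (rule ideal_span_scale)
    from ideal_span_add[OF this step.IH]
    have "c * (a * t) + b * t \<in> ideal_span (S' * T)" .
    moreover have "c * (a * t) + b * t = (c * a + b) * t"
      by (simp add: algebra_simps)
    ultimately show ?case by (simp only:)
  qed
  with z show "z \<in> ideal_span (S' * T)" by simp
qed

text \<open>\<open>S * T\<close> is the elementwise product of generating sets, so its span is the
  product ideal. Independence of the generators lets ideals be handled through small generating
  sets, with the monoid laws for sets doing the reordering.\<close>

lemma span_times_cong:
  fixes S S' T :: "'r::comm_ring_1 set"
  assumes "ideal_span S = ideal_span S'"
  shows "ideal_span (S * T) = ideal_span (S' * T)"
  using assms span_times_mono by (metis ideal_span_eq)

lemma span_times_cong2:
  fixes S S' T T' :: "'r::comm_ring_1 set"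
  assumes "ideal_span S = ideal_span S'" "ideal_span T = ideal_span T'"
  shows "ideal_span (S * T) = ideal_span (S' * T')"
  using span_times_cong[OF assms(1), of T] span_times_cong[OF assms(2), of S']
  by (simp add: mult.commute)

lemma singleton_times:
  fixes a b :: "'r::comm_monoid_mult" and S :: "'r set"
  shows "{a} * {b} = {a * b}" and "{1} * S = S" and "S * {1} = S"
  by (auto simp: set_times_image image_iff)

lemma singleton_times_assoc:
  fixes a b :: "'r::comm_monoid_mult"
  shows "{a * b} * S = {a} * ({b} * S)"
  unfolding singleton_times(1)[symmetric] by (rule mult.assoc)

lemma span_singleton_times:
  fixes a :: "'r::comm_ring_1"
  shows "ideal_span ({a} * S) = (*) a ` ideal_span S"
proof -
  have "module_hom (*) (*) ((*) a)"
    unfolding module_hom_iff by (simp add: module_mult distrib_left mult.left_commute)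
  then have "ideal_span ((*) a ` S) = (*) a ` ideal_span S"
    by (rule module_hom.span_image)
  moreover have "{a} * S = (*) a ` S"
    by (auto simp: set_times_image)
  ultimately show ?thesis by simp
qed

lemma span_singleton_times_cancel:
  fixes a :: "'r::idom"
  assumes "a \<noteq> 0" "ideal_span ({a} * S) = ideal_span ({a} * T)"
  shows "ideal_span S = ideal_span T"
proof -
  have "inj ((*) a)" using assms(1) by (simp add: inj_on_def)
  with assms(2) show ?thesis by (simp add: span_singleton_times inj_image_eq_iff)
qed

text \<open>Equality in the ideal class group. The two principal factors replace a quotient
  \<open>b / a\<close> from the fraction field, so no fractional ideals are required.\<close>

definition same_class :: "'r::idom set \<Rightarrow> 'r set \<Rightarrow> bool" where
  "same_class S T \<longleftrightarrow> (\<exists>a b. a \<noteq> 0 \<and> b \<noteq> 0 \<and> ideal_span ({a} * S) = ideal_span ({b} * T))"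

lemma same_classI:
  assumes "a \<noteq> 0" "b \<noteq> 0" "ideal_span ({a} * S) = ideal_span ({b} * T)"
  shows "same_class S T"
  unfolding same_class_def by (intro exI conjI) (fact assms)+

lemma same_classE:
  assumes "same_class S T"
  obtains a b where "a \<noteq> 0" "b \<noteq> 0" "ideal_span ({a} * S) = ideal_span ({b} * T)"
  using assms unfolding same_class_def by (elim exE conjE) (rule that)

lemma same_class_refl: "same_class S S"
  by (rule same_classI[of 1 1]) (rule one_neq_zero one_neq_zero refl)+

lemma same_class_sym:
  assumes "same_class S T"
  shows "same_class T S"
  using assms by (elim same_classE) (rule same_classI, assumption+, erule sym)

lemma same_class_trans [trans]:
  assumes "same_class S T" "same_class T U"
  shows "same_class S U"
proof -
  obtain a b where nz: "a \<noteq> 0" "b \<noteq> 0"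
    and 1: "ideal_span ({a} * S) = ideal_span ({b} * T)"
    using assms(1) by (rule same_classE)
  obtain c d where nz': "c \<noteq> 0" "d \<noteq> 0"
    and 2: "ideal_span ({c} * T) = ideal_span ({d} * U)"
    using assms(2) by (rule same_classE)
  have "{c * a} * S = ({a} * S) * {c}"
    unfolding singleton_times_assoc by (rule mult.commute)
  also have "ideal_span \<dots> = ideal_span (({b} * T) * {c})"
    by (rule span_times_cong[OF 1])
  also have "({b} * T) * {c} = ({c} * T) * {b}"
    by (metis mult.commute mult.left_commute)
  also have "ideal_span \<dots> = ideal_span (({d} * U) * {b})"
    by (rule span_times_cong[OF 2])
  also have "({d} * U) * {b} = {b * d} * U"
    unfolding singleton_times_assoc by (rule mult.commute)
  finally show ?thesis
    using nz nz' by (intro same_classI[of "c * a" "b * d"]) simp_all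
qed

lemma same_class_times_right:
  assumes "same_class S T"
  shows "same_class (S * U) (T * U)"
proof -
  obtain a b where nz: "a \<noteq> 0" "b \<noteq> 0"
    and eq: "ideal_span ({a} * S) = ideal_span ({b} * T)"
    using assms by (rule same_classE)
  from span_times_cong[OF eq, of U]
  have "ideal_span ({a} * (S * U)) = ideal_span ({b} * (T * U))"
    unfolding mult.assoc .
  with nz show ?thesis by (rule same_classI)
qed

section \<open>Ideal identities behind vertical lines, secants and tangents\<close>

lemma span_eqI:
  fixes S T :: "'r::comm_ring_1 set"
  assumes "S \<subseteq> ideal_span T" "T \<subseteq> ideal_span S"
  shows "ideal_span S = ideal_span T"
  by (rule iffD2[OF ideal_span_eq conjI[OF assms]])

lemma span_memI2:
  fixes a :: "'r::comm_ring_1"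
  assumes "a \<in> ideal_span S" "b \<in> ideal_span S" "z = c * a + d * b"
  shows "z \<in> ideal_span S"
  unfolding assms(3) by (intro ideal_span_add ideal_span_scale assms)

text \<open>The vertical line at \<open>u\<close> meets the curve in \<open>(u, v)\<close> and
  \<open>(u, - v)\<close>. For the harder inclusion, combinations of the generators give
  \<open>2 * v ^ 2 * (x - u)\<close> and \<open>3 * u ^ 3 * (x - u)\<close>; after division by 2 and
  3, via \<open>h\<close> and \<open>h'\<close>, their difference is \<open>x - u\<close> because
  \<open>v ^ 2 - u ^ 3 = 1\<close>.\<close>

lemma span_conjugate_points:
  fixes x y u v h h' :: "'r::idom"
  assumes xy: "y ^ 2 = x ^ 3 + 1" and uv: "v ^ 2 = u ^ 3 + 1"
    and h: "2 * h = 1" "3 * h' = 1"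
  shows "ideal_span ({x - u, y - v} * {x - u, y + v}) = ideal_span {x - u}"
proof (rule span_eqI)
  have p: "(y - v) * (y + v) = (x - u) * (x ^ 2 + u * x + u ^ 2)"
    using xy uv by (simp add: algebra_simps power2_eq_square power3_eq_cube)
  then show "{x - u, y - v} * {x - u, y + v} \<subseteq> ideal_span {x - u}"
    by (auto simp: set_times_image ideal_span_singleton image_def mult_ac)
  let ?I = "ideal_span ({x - u, y - v} * {x - u, y + v})"
  have mem: "(x - u) * (x - u) \<in> ?I" "(x - u) * (y + v) \<in> ?I"
    "(y - v) * (x - u) \<in> ?I" "(y - v) * (y + v) \<in> ?I"
    by (auto intro!: ideal_span_base)
  have "h * v * ((x - u) * (y + v) - (y - v) * (x - u))
      - h' * u * ((y - v) * (y + v) - (x + 2 * u) * ((x - u) * (x - u))) \<in> ?I"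
    by (intro ideal_span_diff ideal_span_scale mem)
  moreover have "h * v * ((x - u) * (y + v) - (y - v) * (x - u))
      - h' * u * ((y - v) * (y + v) - (x + 2 * u) * ((x - u) * (x - u))) = x - u"
  proof -
    have "h * v * ((x - u) * (y + v) - (y - v) * (x - u)) = (2 * h) * v ^ 2 * (x - u)"
      by (simp add: algebra_simps power2_eq_square)
    moreover have "h' * u * ((y - v) * (y + v) - (x + 2 * u) * ((x - u) * (x - u)))
      = (3 * h') * u ^ 3 * (x - u)"
      unfolding p by (simp add: algebra_simps power2_eq_square power3_eq_cube)
    ultimately have "h * v * ((x - u) * (y + v) - (y - v) * (x - u))
      - h' * u * ((y - v) * (y + v) - (x + 2 * u) * ((x - u) * (x - u)))
      = v ^ 2 * (x - u) - u ^ 3 * (x - u)"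
      by (simp only: h mult_1)
    then show ?thesis
      unfolding uv by (simp add: algebra_simps)
  qed
  ultimately show "{x - u} \<subseteq> ?I" by simp
qed

text \<open>The line \<open>l\<close> passes through the points 1 and 2 and through
  \<open>(u3, - v3)\<close>, so its ideal is the product of the ideals of these three. Multiplying
  by the ideal of \<open>(u3, v3)\<close> turns the last factor into \<open>x - u3\<close>. The
  hypotheses \<open>s1\<close>, \<open>s2\<close>, \<open>s3\<close> are Vieta's formulas for the
  intersection; membership of \<open>l\<close> is left as a hypothesis because secants and tangents
  obtain it differently.\<close>

lemma span_line:
  fixes x y u1 v1 u2 v2 u3 v3 m :: "'r::idom"
  defines "I \<equiv> {x - u1, y - v1} * {x - u2, y - v2}" and "l \<equiv> y - v1 - m * (x - u1)"
  assumes xy: "y ^ 2 = x ^ 3 + 1"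
    and v2: "v2 = m * (u2 - u1) + v1" and v3: "v3 = m * (u1 - u3) - v1"
    and s1: "u1 + u2 + u3 = m ^ 2"
    and s2: "u1 * u2 + u1 * u3 + u2 * u3 = - 2 * m * (v1 - m * u1)"
    and s3: "u1 * u2 * u3 = (v1 - m * u1) ^ 2 - 1"
    and l: "l \<in> ideal_span I"
  shows "ideal_span (I * {x - u3}) = ideal_span ({l} * {x - u3, y - v3})"
proof (rule span_eqI)
  let ?J = "ideal_span ({l} * {x - u3, y - v3})"
  have J: "l * (x - u3) \<in> ?J" "l * (y - v3) \<in> ?J"
    by (auto intro!: ideal_span_base)
  have "(x - u1) * (x - u2) * (x - u3) = x ^ 3 + 1 - (m * (x - u1) + v1) ^ 2"
  proof -
    have "(x - u1) * (x - u2) * (x - u3)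
      = x ^ 3 - (u1 + u2 + u3) * x ^ 2 + (u1 * u2 + u1 * u3 + u2 * u3) * x - u1 * u2 * u3"
      by (simp add: algebra_simps power2_eq_square power3_eq_cube)
    also have "\<dots> = x ^ 3 + 1 - (m * (x - u1) + v1) ^ 2"
      unfolding s1 s2 s3 by (simp add: algebra_simps power2_eq_square)
    finally show ?thesis .
  qed
  \<comment> \<open>With \<open>L = m * (x - u1) + v1\<close> the cubic is
    \<open>y ^ 2 - L ^ 2 = (y - L) * (y + L)\<close>. Here \<open>y - L\<close> is \<open>l\<close>
    and \<open>y + L\<close> is \<open>(y - v3) + m * (x - u3)\<close>.\<close>
  then have p: "(x - u1) * (x - u2) * (x - u3) = l * (y - v3) + m * (l * (x - u3))"
    unfolding l_def v3 using xy by algebra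
  then have pJ: "(x - u1) * (x - u2) * (x - u3) \<in> ?J"
    by (simp only: p) (intro ideal_span_add ideal_span_scale J)
  \<comment> \<open>Substituting \<open>y - v1 = l + m * (x - u1)\<close> and
    \<open>y - v2 = l + m * (x - u2)\<close> splits each remaining generator into a multiple of
    \<open>l * (x - u3)\<close> and a multiple of the cubic.\<close>
  have 1: "(x - u1) * (y - v2) * (x - u3) \<in> ?J"
    by (rule span_memI2[OF J(1) pJ, of _ "x - u1" m]) (simp add: v2 l_def algebra_simps power2_eq_square)
  have 2: "(y - v1) * (x - u2) * (x - u3) \<in> ?J"
    by (rule span_memI2[OF J(1) pJ, of _ "x - u2" m]) (simp add: v2 l_def algebra_simps power2_eq_square)
  have 3: "(y - v1) * (y - v2) * (x - u3) \<in> ?J"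
    by (rule span_memI2[OF J(1) pJ, of _ "l + m * (x - u1) + m * (x - u2)" "m ^ 2"])
       (simp add: v2 l_def algebra_simps power2_eq_square)
  show "I * {x - u3} \<subseteq> ?J"
    unfolding I_def using pJ 1 2 3 by (auto elim!: set_times_elim)
  have lI: "l * (x - u3) \<in> ideal_span (I * {x - u3})"
    using span_times_mono[of "{l}" I "{x - u3}"] l by auto
  have pI: "(x - u1) * (x - u2) * (x - u3) \<in> ideal_span (I * {x - u3})"
    unfolding I_def by (intro ideal_span_base) auto
  have "l * (y - v3) \<in> ideal_span (I * {x - u3})"
    by (rule span_memI2[OF pI lI, of _ 1 "- m"]) (use p in algebra)
  with lI show "{l} * {x - u3, y - v3} \<subseteq> ideal_span (I * {x - u3})"
    by (auto elim!: set_times_elim)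
qed

text \<open>The difference \<open>(x - u1) * (y - v2) - (y - v1) * (x - u2)\<close> is
  \<open>u2 - u1\<close> times the equation of the secant, and \<open>k\<close> inverts that
  factor.\<close>

lemma secant_in_span:
  fixes x y u1 v1 u2 v2 m k :: "'r::idom"
  assumes "v2 = m * (u2 - u1) + v1" "k * (u2 - u1) = 1"
  shows "y - v1 - m * (x - u1) \<in> ideal_span ({x - u1, y - v1} * {x - u2, y - v2})"
proof -
  let ?I = "ideal_span ({x - u1, y - v1} * {x - u2, y - v2})"
  have "(x - u1) * (y - v2) \<in> ?I" "(y - v1) * (x - u2) \<in> ?I"
    by (auto intro!: ideal_span_base)
  then show ?thesis
    by (rule span_memI2[of _ _ _ _ k "- k"]) (use assms in algebra)
qed

text \<open>Expanding the curve equation at \<open>(u, v)\<close> shows that its linear part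
  \<open>2 * v * (y - v) - 3 * u ^ 2 * (x - u)\<close> equals
  \<open>(x + 2 * u) * (x - u) ^ 2 - (y - v) ^ 2\<close>, which lies in the square of the ideal. The
  linear part is \<open>2 * v\<close> times the tangent, and \<open>k\<close> inverts
  \<open>2 * v\<close>.\<close>

lemma tangent_in_span:
  fixes x y u v m k :: "'r::idom"
  assumes "y ^ 2 = x ^ 3 + 1" "v ^ 2 = u ^ 3 + 1" "2 * v * m = 3 * u ^ 2" "k * (2 * v) = 1"
  shows "y - v - m * (x - u) \<in> ideal_span ({x - u, y - v} * {x - u, y - v})"
proof -
  let ?I = "ideal_span ({x - u, y - v} * {x - u, y - v})"
  have "(x - u) * (x - u) \<in> ?I" "(y - v) * (y - v) \<in> ?I"
    by (auto intro!: ideal_span_base)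
  moreover have "y - v - m * (x - u)
    = k * (x + 2 * u) * ((x - u) * (x - u)) + - k * ((y - v) * (y - v))"
  proof -
    have "(x + 2 * u) * ((x - u) * (x - u)) - (y - v) * (y - v)
      = 2 * v * (y - v) - 3 * u ^ 2 * (x - u) + (x ^ 3 + 1 - y ^ 2) - (u ^ 3 + 1 - v ^ 2)"
      by (simp add: algebra_simps power2_eq_square power3_eq_cube)
    also have "\<dots> = 2 * v * (y - v) - 3 * u ^ 2 * (x - u)"
      unfolding assms(1,2) by simp
    also have "\<dots> = 2 * v * (y - v - m * (x - u))"
      by (simp add: assms(3)[symmetric] algebra_simps)
    finally have "k * ((x + 2 * u) * ((x - u) * (x - u)) - (y - v) * (y - v))
      = (k * (2 * v)) * (y - v - m * (x - u))" by simp
    then show ?thesis unfolding assms(4) by (simp add: algebra_simps)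
  qed
  ultimately show ?thesis by (rule span_memI2)
qed

section \<open>The coordinate ring\<close>

context notes [[typedef_overloaded]]
begin

text \<open>\<open>CR f g\<close> stands for \<open>f(X) + g(X) Y\<close> in
  \<open>K[X, Y] / (Y^2 - X^3 - 1)\<close>; multiplication replaces \<open>Y^2\<close> by
  \<open>cubic\<close>. Normal forms avoid a quotient construction.\<close>

datatype 'a coord_ring = CR (rpart: "'a poly") (ypart: "'a poly")

end

definition cubic :: "'a::comm_ring_1 poly" where
  "cubic = [:1, 0, 0, 1:]"

instantiation coord_ring :: (comm_ring_1) comm_ring_1
begin

definition "0 = CR 0 0"
definition "1 = CR 1 0"
definition "f + g = CR (rpart f + rpart g) (ypart f + ypart g)"
definition "f - g = CR (rpart f - rpart g) (ypart f - ypart g)"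
definition "- f = CR (- rpart f) (- ypart f)"
definition "f * g = CR (rpart f * rpart g + ypart f * ypart g * cubic)
  (rpart f * ypart g + ypart f * rpart g)"

instance
  by standard
    (simp_all add: zero_coord_ring_def one_coord_ring_def plus_coord_ring_def
      minus_coord_ring_def uminus_coord_ring_def times_coord_ring_def algebra_simps)

end

lemma coord_ring_sel [simp]:
  "rpart 0 = 0" "ypart 0 = 0" "rpart 1 = 1" "ypart 1 = 0"
  "rpart (f + g) = rpart f + rpart g" "ypart (f + g) = ypart f + ypart g"
  "rpart (f - g) = rpart f - rpart g" "ypart (f - g) = ypart f - ypart g"
  "rpart (- f) = - rpart f" "ypart (- f) = - ypart f"
  "rpart (f * g) = rpart f * rpart g + ypart f * ypart g * cubic"
  "ypart (f * g) = rpart f * ypart g + ypart f * rpart g"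
  by (simp_all add: zero_coord_ring_def one_coord_ring_def plus_coord_ring_def
      minus_coord_ring_def uminus_coord_ring_def times_coord_ring_def)

definition cr_conj :: "'a::comm_ring_1 coord_ring \<Rightarrow> 'a coord_ring" where
  "cr_conj f = CR (rpart f) (- ypart f)"

definition cr_norm :: "'a::comm_ring_1 coord_ring \<Rightarrow> 'a poly" where
  "cr_norm f = rpart f ^ 2 - ypart f ^ 2 * cubic"

lemma cr_norm_mult: "cr_norm (f * g) = cr_norm f * cr_norm g"
  by (simp add: cr_norm_def algebra_simps power2_eq_square)

lemma mult_cr_conj: "f * cr_conj f = CR (cr_norm f) 0"
  by (simp add: coord_ring.expand cr_conj_def cr_norm_def algebra_simps power2_eq_square)

lemma cr_conj_mult: "cr_conj (f * g) = cr_conj f * cr_conj g"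
  by (simp add: coord_ring.expand cr_conj_def algebra_simps)

lemma cr_conj_add: "cr_conj (f + g) = cr_conj f + cr_conj g"
  by (simp add: coord_ring.expand cr_conj_def algebra_simps)

text \<open>The two summands of the norm have degrees of different parity.\<close>

lemma degree_cr_norm:
  fixes f :: "'a::field coord_ring"
  assumes "ypart f \<noteq> 0"
  shows "cr_norm f \<noteq> 0 \<and> degree (cr_norm f) \<ge> 3"
proof -
  have cub: "degree (cubic :: 'a poly) = 3" "(cubic :: 'a poly) \<noteq> 0"
    by (simp_all add: cubic_def)
  have d2: "degree (ypart f ^ 2 * cubic) = 2 * degree (ypart f) + 3"
    using assms cub by (simp add: degree_mult_eq degree_power_eq)
  have d1: "degree (rpart f ^ 2) = 2 * degree (rpart f)"
    by (cases "rpart f = 0") (simp_all add: degree_power_eq)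
  have ne: "degree (rpart f ^ 2) \<noteq> degree (ypart f ^ 2 * cubic)"
    unfolding d1 d2 by presburger
  have "degree (cr_norm f) \<ge> 3"
  proof (cases "degree (rpart f ^ 2) < degree (ypart f ^ 2 * cubic)")
    case True
    then show ?thesis
      using degree_add_eq_right[of "rpart f ^ 2" "- (ypart f ^ 2 * cubic)"] d2
      by (simp add: cr_norm_def)
  next
    case False
    with ne have "degree (ypart f ^ 2 * cubic) < degree (rpart f ^ 2)" by simp
    then show ?thesis
      using degree_add_eq_left[of "- (ypart f ^ 2 * cubic)" "rpart f ^ 2"] d2
      by (simp add: cr_norm_def)
  qed
  then show ?thesis by auto
qed

lemma cr_norm_eq_0_iff:
  fixes f :: "'a::field coord_ring"
  shows "cr_norm f = 0 \<longleftrightarrow> f = 0"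
proof
  assume 0: "cr_norm f = 0"
  then have "ypart f = 0" using degree_cr_norm by blast
  with 0 show "f = 0" by (simp add: coord_ring.expand cr_norm_def)
qed (simp add: cr_norm_def)

instance coord_ring :: (field) idom
proof
  fix f g :: "'a coord_ring"
  assume "f \<noteq> 0" "g \<noteq> 0"
  then have "cr_norm (f * g) \<noteq> 0"
    by (simp add: cr_norm_mult cr_norm_eq_0_iff)
  then show "f * g \<noteq> 0" by (simp add: cr_norm_eq_0_iff)
qed

section \<open>Points of the curve as ideals of the coordinate ring\<close>

definition cst :: "'a::comm_ring_1 \<Rightarrow> 'a coord_ring" where
  "cst c = CR [:c:] 0"

definition Xc :: "'a::comm_ring_1 coord_ring" where "Xc = CR [:0, 1:] 0"
definition Yc :: "'a::comm_ring_1 coord_ring" where "Yc = CR 0 1"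

lemma cst_hom:
  "cst 0 = 0" "cst 1 = 1" "cst (a + b) = cst a + cst b" "cst (a - b) = cst a - cst b"
  "cst (- a) = - cst a" "cst (a * b) = cst a * cst b"
  by (simp_all add: cst_def coord_ring.expand one_pCons)

lemma cst_power: "cst (a ^ n) = cst a ^ n"
  by (induction n) (simp_all add: cst_hom)

lemma cst_numeral: "cst (numeral n) = numeral n"
proof -
  have "cst (of_nat m) = of_nat m" for m
    by (induction m) (simp_all add: cst_hom)
  from this[of "numeral n"] show ?thesis by simp
qed

lemma Yc_power2: "Yc ^ 2 = Xc ^ 3 + 1"
  by (simp add: coord_ring.expand Xc_def Yc_def cubic_def power2_eq_square power3_eq_cube one_pCons)

lemma Xc_neq_cst [simp]: "Xc \<noteq> cst u"
  by (auto simp: Xc_def cst_def dest: arg_cong[of _ _ rpart])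

text \<open>\<open>Infinity\<close> is invisible on the affine curve and gets the unit ideal, whose
  class is the identity.\<close>

fun gens :: "'a::comm_ring_1 ec_point \<Rightarrow> 'a coord_ring set" where
  "gens Infinity = {1}"
| "gens (Affine u v) = {Xc - cst u, Yc - cst v}"

fun ec_neg :: "'a::ab_group_add ec_point \<Rightarrow> 'a ec_point" where
  "ec_neg Infinity = Infinity"
| "ec_neg (Affine x y) = Affine x (- y)"

abbreviation E :: "'a::field ec_point set" where "E \<equiv> ec_points 0 1"

lemma Infinity_in_E [simp]: "Infinity \<in> ec_points a b"
  by (simp add: ec_points_def)

lemma Affine_in_E [simp]: "Affine x y \<in> E \<longleftrightarrow> y ^ 2 = x ^ 3 + 1"
  by (simp add: ec_points_def)

lemma ec_neg_in_E [simp]: "P \<in> E \<Longrightarrow> ec_neg P \<in> E"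
  by (cases P) simp_all

text \<open>Vieta's formulas for the cubic obtained by intersecting the curve with the secant or
  tangent line.\<close>

lemma vieta_line:
  fixes u1 v1 u2 v2 m :: "'a::field_char_0"
  assumes E: "v1 ^ 2 = u1 ^ 3 + 1" "v2 ^ 2 = u2 ^ 3 + 1" and ne: "\<not> (u1 = u2 \<and> v1 = - v2)"
    and m: "m = (if u1 = u2 then (3 * u1 ^ 2 + 0) / (2 * v1) else (v2 - v1) / (u2 - u1))"
    and u3: "u3 = m ^ 2 - u1 - u2"
  shows "v2 = m * (u2 - u1) + v1"
    and "u1 * u2 + u1 * u3 + u2 * u3 = - 2 * m * (v1 - m * u1)"
    and "u1 * u2 * u3 = (v1 - m * u1) ^ 2 - 1"
    and "u1 = u2 \<Longrightarrow> v1 = v2 \<and> v1 \<noteq> 0 \<and> 2 * v1 * m = 3 * u1 ^ 2"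
proof -
  have *: "v1 = v2 \<and> v1 \<noteq> 0 \<and> 2 * v1 * m = 3 * u1 ^ 2" if "u1 = u2"
  proof -
    have "(v1 - v2) * (v1 + v2) = 0" using E that by algebra
    with ne that have 1: "v1 = v2" by (auto simp: add_eq_0_iff)
    with ne that have 2: "v1 \<noteq> 0" by auto
    with m that show ?thesis using 1 by simp
  qed
  show "u1 = u2 \<Longrightarrow> v1 = v2 \<and> v1 \<noteq> 0 \<and> 2 * v1 * m = 3 * u1 ^ 2" using * .
  have **: "m * (u2 - u1) = v2 - v1" if "u1 \<noteq> u2" using m that by simp
  show "v2 = m * (u2 - u1) + v1" using * ** by (cases "u1 = u2") auto
  show s2: "u1 * u2 + u1 * u3 + u2 * u3 = - 2 * m * (v1 - m * u1)"
  proof (cases "u1 = u2")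
    case True
    with * have "2 * v1 * m = 3 * u1 ^ 2" by blast
    moreover have "u1 * u2 + u1 * u3 + u2 * u3 + 2 * m * (v1 - m * u1) = 2 * v1 * m - 3 * u1 ^ 2"
      unfolding u3 True[symmetric] by (simp add: algebra_simps power2_eq_square)
    ultimately have "u1 * u2 + u1 * u3 + u2 * u3 + 2 * m * (v1 - m * u1) = 0" by simp
    then show ?thesis by (simp add: add_eq_0_iff)
  next
    case False
    \<comment> \<open>Subtracting the two curve equations gives the formula up to the factor
      \<open>u2 - u1\<close>, which is nonzero here.\<close>
    have "(u2 - u1) * (u1 * u2 + u1 * u3 + u2 * u3 + 2 * m * (v1 - m * u1)) = 0"
      using **[OF False] E u3 by algebra
    with False have "u1 * u2 + u1 * u3 + u2 * u3 + 2 * m * (v1 - m * u1) = 0" by simp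
    then show ?thesis by (simp add: add_eq_0_iff)
  qed
  \<comment> \<open>The monic cubic with roots \<open>u1\<close>, \<open>u2\<close>,
    \<open>u3\<close>, evaluated at its root \<open>u1\<close>. Two coefficients are known by now,
    so the curve equation at \<open>u1\<close> determines the third.\<close>
  have "u1 ^ 3 - (u1 + u2 + u3) * u1 ^ 2 + (u1 * u2 + u1 * u3 + u2 * u3) * u1 - u1 * u2 * u3 = 0"
    by (simp add: algebra_simps power2_eq_square power3_eq_cube)
  with s2 E(1) u3 show "u1 * u2 * u3 = (v1 - m * u1) ^ 2 - 1" by algebra
qed

lemma ec_add_in_E:
  fixes P Q :: "'a::field_char_0 ec_point"
  assumes "P \<in> E" "Q \<in> E"
  shows "ec_add 0 P Q \<in> E"
proof (cases P; cases Q)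
  fix u1 v1 u2 v2
  assume PQ: "P = Affine u1 v1" "Q = Affine u2 v2"
  show ?thesis
  proof (cases "u1 = u2 \<and> v1 = - v2")
    case False
    \<comment> \<open>The summand 0 is the coefficient \<open>a\<close> of the curve. It is kept so
      that \<open>m\<close> agrees literally with the slope in the unfolded \<open>ec_add\<close>,
      which is why \<open>add_0_right\<close> is removed below.\<close>
    define m where "m = (if u1 = u2 then (3 * u1 ^ 2 + 0) / (2 * v1) else (v2 - v1) / (u2 - u1))"
    define u3 where "u3 = m ^ 2 - u1 - u2"
    have "ec_add 0 P Q = Affine u3 (m * (u1 - u3) - v1)"
      using False by (simp add: PQ m_def u3_def Let_def del: add_0_right)
    moreover have "(m * (u1 - u3) - v1) ^ 2 = u3 ^ 3 + 1"
    proof -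
      \<comment> \<open>The same cubic at its root \<open>u3\<close>. By Vieta's formulas it is
        \<open>t ^ 3 + 1\<close> minus the square of the line, so the third intersection lies on the
        curve.\<close>
      have "u3 ^ 3 - (u1 + u2 + u3) * u3 ^ 2 + (u1 * u2 + u1 * u3 + u2 * u3) * u3 - u1 * u2 * u3 = 0"
        by (simp add: algebra_simps power2_eq_square power3_eq_cube)
      moreover have E: "v1 ^ 2 = u1 ^ 3 + 1" "v2 ^ 2 = u2 ^ 3 + 1" using assms PQ by simp_all
      note vieta_line(2,3)[OF E False m_def u3_def]
      moreover have "u1 + u2 + u3 = m ^ 2" by (simp add: u3_def)
      ultimately show ?thesis by algebra
    qed
    ultimately show ?thesis by simp
  qed (simp add: PQ)
qed (use assms in simp_all)

lemma gens_mult_neg: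
  fixes u :: "'a::field_char_0"
  assumes "Affine u v \<in> E"
  shows "ideal_span (gens (Affine u v) * gens (Affine u (- v))) = ideal_span {Xc - cst u}"
proof -
  have "cst v ^ 2 = cst u ^ 3 + 1"
    using assms by (simp flip: cst_power add: cst_hom)
  moreover have "2 * cst (1 / 2 :: 'a) = 1" "3 * cst (1 / 3 :: 'a) = 1"
    by (simp_all flip: cst_numeral cst_hom)
  ultimately show ?thesis
    using span_conjugate_points[OF Yc_power2, of "cst v" "cst u"] by (simp add: cst_hom)
qed

text \<open>For opposite points the product ideal is generated by the vertical line
  \<open>Xc - cst u1\<close>. Otherwise \<open>span_line\<close> relates the product ideal and the
  ideal of the sum through the factors \<open>Xc - cst u3\<close> and \<open>l\<close>, and
  \<open>l\<close> is nonzero because its coefficient at \<open>Y\<close> is 1.\<close>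

lemma gens_add_same_class:
  fixes P Q :: "'a::field_char_0 ec_point"
  assumes "P \<in> E" "Q \<in> E"
  shows "same_class (gens P * gens Q) (gens (ec_add 0 P Q))"
proof (cases P; cases Q)
  fix u1 v1 u2 v2
  assume PQ: "P = Affine u1 v1" "Q = Affine u2 v2"
  show ?thesis
  proof (cases "u1 = u2 \<and> v1 = - v2")
    case True
    have "ideal_span ({1} * (gens P * gens Q)) = ideal_span ({Xc - cst u1} * {1})"
      using gens_mult_neg[of u1 v1] True assms PQ by (simp add: set_times_image)
    then show ?thesis using True PQ by (intro same_classI[of 1 "Xc - cst u1"]) simp_all
  next
    case False
    define m where "m = (if u1 = u2 then (3 * u1 ^ 2 + 0) / (2 * v1) else (v2 - v1) / (u2 - u1))"
    define u3 where "u3 = m ^ 2 - u1 - u2"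
    define v3 where "v3 = m * (u1 - u3) - v1"
    define l where "l = Yc - cst v1 - cst m * (Xc - cst u1)"
    have sum: "ec_add 0 P Q = Affine u3 v3"
      using False by (simp add: PQ m_def u3_def v3_def Let_def del: add_0_right)
    have E: "v1 ^ 2 = u1 ^ 3 + 1" "v2 ^ 2 = u2 ^ 3 + 1" using assms PQ by simp_all
    note V = vieta_line[OF E False m_def u3_def]
    have v2: "cst v2 = cst m * (cst u2 - cst u1) + cst v1"
      by (subst V(1)) (simp add: cst_hom)
    have l_mem: "l \<in> ideal_span (gens P * gens Q)"
    proof (cases "u1 = u2")
      case True
      from V(4)[OF True] have "v1 \<noteq> 0" and h: "2 * v1 * m = 3 * u1 ^ 2" by blast+
      then have "cst (1 / (2 * v1)) * (2 * cst v1) = 1"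
        by (simp flip: cst_numeral cst_hom)
      moreover have "2 * cst v1 * cst m = 3 * cst u1 ^ 2" "cst v1 ^ 2 = cst u1 ^ 3 + 1"
        using h E(1) by (simp_all flip: cst_numeral cst_hom cst_power)
      ultimately show ?thesis
        using tangent_in_span[OF Yc_power2, of "cst v1" "cst u1" "cst m" "cst (1 / (2 * v1))"]
          V(4)[OF True] True by (simp add: l_def PQ)
    next
      case False
      then have "cst (1 / (u2 - u1)) * (cst u2 - cst u1) = 1"
        by (simp flip: cst_hom)
      from secant_in_span[OF v2 this, of Yc Xc] show ?thesis by (simp add: l_def PQ)
    qed
    have "ideal_span (gens P * gens Q * {Xc - cst u3}) = ideal_span ({l} * gens (Affine u3 v3))"
      unfolding PQ gens.simps l_def
    proof (rule span_line[OF Yc_power2 v2])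
      show "cst u1 + cst u2 + cst u3 = cst m ^ 2"
        by (simp add: u3_def flip: cst_hom cst_power)
      show "cst u1 * cst u2 + cst u1 * cst u3 + cst u2 * cst u3
          = - 2 * cst m * (cst v1 - cst m * cst u1)"
        using V(2) by (simp flip: cst_hom cst_power cst_numeral)
      show "cst u1 * cst u2 * cst u3 = (cst v1 - cst m * cst u1)\<^sup>2 - 1"
        using V(3) by (simp flip: cst_hom cst_power)
      show "cst v3 = cst m * (cst u1 - cst u3) - cst v1"
        by (simp add: v3_def cst_hom)
      show "Yc - cst v1 - cst m * (Xc - cst u1)
          \<in> ideal_span ({Xc - cst u1, Yc - cst v1} * {Xc - cst u2, Yc - cst v2})"
        using l_mem by (simp add: l_def PQ)
    qed
    moreover have "l \<noteq> 0"
      by (auto simp: l_def Xc_def Yc_def cst_def dest: arg_cong[of _ _ ypart])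
    ultimately show ?thesis
      unfolding sum by (intro same_classI[of "Xc - cst u3" l]) (simp_all add: mult.commute)
  qed
qed (simp_all add: singleton_times same_class_refl)

section \<open>Associativity of the chord-tangent law\<close>

lemma cr_conj_mem_span:
  assumes "z \<in> ideal_span S"
  shows "cr_conj z \<in> ideal_span (cr_conj ` S)"
  using assms
proof (induction rule: ideal_span_induct_alt)
  case base
  have "cr_conj 0 = (0 :: 'a coord_ring)"
    by (simp add: coord_ring.expand cr_conj_def)
  then show ?case by (simp only: ideal_span_zero)
next
  case (step c a b)
  then show ?case
    unfolding cr_conj_add cr_conj_mult
    by (intro ideal_span_add ideal_span_scale) (auto intro: ideal_span_base)
qed

lemma ideal_span_cr_conj_cong:
  assumes "ideal_span S = ideal_span T"
  shows "ideal_span (cr_conj ` S) = ideal_span (cr_conj ` T)"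
proof -
  have "cr_conj ` S \<subseteq> ideal_span (cr_conj ` T)" if "ideal_span S = ideal_span T"
    for S T :: "'a coord_ring set"
    using that ideal_span_base[of _ S] cr_conj_mem_span[of _ T] by blast
  with assms show ?thesis by (intro span_eqI) auto
qed

text \<open>Conjugation is \<open>Y -> - Y\<close>, so it sends \<open>Y - v\<close> to
  \<open>- (Y + v)\<close>: the generators agree up to sign.\<close>

lemma ideal_span_cr_conj_gens:
  "ideal_span (cr_conj ` gens P) = ideal_span (gens (ec_neg P))"
proof (cases P)
  case (Affine u v)
  have c: "cr_conj (Xc - cst u) = Xc - cst u" "cr_conj (Yc - cst v) = - (Yc - cst (- v))"
    by (simp_all add: coord_ring.expand cr_conj_def Xc_def Yc_def cst_def)
  show ?thesis
  proof (rule span_eqI)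
    show "cr_conj ` gens P \<subseteq> ideal_span (gens (ec_neg P))"
      using ideal_span_base[of _ "gens (ec_neg P)"] ideal_span_scale[of "Yc - cst (- v)" _ "-1"]
      unfolding Affine by (auto simp: c simp del: minus_diff_eq)
    have "- cr_conj (Yc - cst v) \<in> ideal_span (cr_conj ` gens P)"
      using ideal_span_scale[of "cr_conj (Yc - cst v)" _ "-1"] ideal_span_base[of _ "cr_conj ` gens P"]
      unfolding Affine by auto
    moreover have "cr_conj (Xc - cst u) \<in> ideal_span (cr_conj ` gens P)"
      unfolding Affine by (intro ideal_span_base) auto
    ultimately show "gens (ec_neg P) \<subseteq> ideal_span (cr_conj ` gens P)"
      unfolding c Affine by simp
  qed
qed (simp add: cr_conj_def one_coord_ring_def)

text \<open>The norm of the ideal of a point: it generates the product of that ideal with its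
  conjugate. The value 1 fits the unit ideal of \<open>Infinity\<close>.\<close>

fun xdiff :: "'a::comm_ring_1 ec_point \<Rightarrow> 'a poly" where
  "xdiff Infinity = 1"
| "xdiff (Affine u v) = [:- u, 1:]"

lemma xdiff_neq_0 [simp]: "xdiff P \<noteq> 0"
  by (cases P) simp_all

lemma ideal_span_gens_neg:
  fixes P :: "'a::field_char_0 ec_point"
  assumes "P \<in> E"
  shows "ideal_span (gens P * gens (ec_neg P)) = ideal_span {CR (xdiff P) 0}"
proof (cases P)
  case Infinity
  then show ?thesis by (simp add: singleton_times) (simp add: one_coord_ring_def)
next
  case (Affine u v)
  have "Xc - cst u = CR (xdiff P) 0"
    by (simp add: Affine coord_ring.expand Xc_def cst_def)
  with Affine assms gens_mult_neg[of u v] show ?thesis by simp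
qed

text \<open>In the class group \<open>gens (ec_neg Q)\<close> is inverse to \<open>gens Q\<close>,
  so equality of classes becomes principality of one integral ideal.\<close>

lemma gens_class_principal:
  fixes P Q :: "'a::field_char_0 ec_point"
  assumes "Q \<in> E" "same_class (gens P) (gens Q)"
  obtains f where "f \<noteq> 0" "ideal_span (gens P * gens (ec_neg Q)) = ideal_span {f}"
proof -
  obtain a b where nz: "a \<noteq> 0" "b \<noteq> 0"
    and eq: "ideal_span ({a} * gens P) = ideal_span ({b} * gens Q)"
    using assms(2) by (rule same_classE)
  define S where "S = gens P * gens (ec_neg Q)"
  define w where "w = b * CR (xdiff Q) 0"
  have "ideal_span ({a} * S) = ideal_span ((gens Q * gens (ec_neg Q)) * {b})"
    using span_times_cong[OF eq, of "gens (ec_neg Q)"] unfolding S_def by (simp only: mult_ac)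
  also have "\<dots> = ideal_span ({CR (xdiff Q) 0} * {b})"
    by (rule span_times_cong[OF ideal_span_gens_neg[OF assms(1)]])
  also have "{CR (xdiff Q) 0} * {b} = {w}"
    by (simp add: w_def singleton_times mult.commute)
  finally have eq': "ideal_span ({a} * S) = ideal_span {w}" .
  \<comment> \<open>Since \<open>a\<close> times the ideal of \<open>S\<close> is generated by
    \<open>w\<close>, the element \<open>w\<close> is divisible by \<open>a\<close>; the quotient is
    the generator sought.\<close>
  have "w \<in> (*) a ` ideal_span S"
    using ideal_span_base[of w "{w}"] eq' by (simp add: span_singleton_times)
  then obtain f where f: "w = a * f" by blast
  have "CR (xdiff Q) 0 \<noteq> 0"
    by (auto dest: arg_cong[of _ _ rpart])
  with f nz have "f \<noteq> 0" by (auto simp: w_def)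
  moreover have "ideal_span S = ideal_span {f}"
    by (rule span_singleton_times_cancel[OF nz(1)]) (simp add: eq' f singleton_times)
  ultimately show ?thesis using that unfolding S_def by blast
qed

lemma cr_conj_set_times: "cr_conj ` (S * T) = cr_conj ` S * cr_conj ` T"
  by (force simp: set_times_image cr_conj_mult image_iff)

text \<open>The generator \<open>f\<close> of the principal ideal has norm associated to
  \<open>xdiff P * xdiff Q\<close>, of degree at most 2. So \<open>f\<close> is a polynomial
  \<open>A\<close> in \<open>X\<close> with \<open>A ^ 2\<close> as norm, and this leaves too little
  room for two distinct points.\<close>

lemma gens_inj:
  fixes P Q :: "'a::field_char_0 ec_point"
  assumes E: "P \<in> E" "Q \<in> E" and same: "same_class (gens P) (gens Q)"
  shows "P = Q"
proof -
  obtain f where f0: "f \<noteq> 0" and f: "ideal_span (gens P * gens (ec_neg Q)) = ideal_span {f}"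
    using gens_class_principal[OF E(2) same] .
  have negneg: "ec_neg (ec_neg R) = R" for R :: "'a ec_point" by (cases R) simp_all
  have "ideal_span {cr_conj f} = ideal_span (cr_conj ` gens P * cr_conj ` gens (ec_neg Q))"
    using ideal_span_cr_conj_cong[OF f] by (simp add: cr_conj_set_times)
  also have "\<dots> = ideal_span (gens (ec_neg P) * gens Q)"
    using span_times_cong2[OF ideal_span_cr_conj_gens ideal_span_cr_conj_gens, of P "ec_neg Q"]
    by (simp add: negneg)
  finally have "ideal_span ({f} * {cr_conj f})
      = ideal_span ((gens P * gens (ec_neg Q)) * (gens (ec_neg P) * gens Q))"
    by (intro span_times_cong2) (simp_all only: f)
  also have "(gens P * gens (ec_neg Q)) * (gens (ec_neg P) * gens Q)
      = (gens P * gens (ec_neg P)) * (gens Q * gens (ec_neg Q))"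
    by (simp only: mult_ac)
  also have "ideal_span \<dots> = ideal_span ({CR (xdiff P) 0} * {CR (xdiff Q) 0})"
    by (intro span_times_cong2 ideal_span_gens_neg E)
  also have "{CR (xdiff P) 0} * {CR (xdiff Q) 0} = {CR (xdiff P * xdiff Q) 0}"
    by (simp add: set_times_image coord_ring.expand)
  finally have eq: "ideal_span {CR (cr_norm f) 0} = ideal_span {CR (xdiff P * xdiff Q) 0}"
    by (simp add: set_times_image mult_cr_conj)
  have dvd: "p dvd q" if "ideal_span {CR p 0} = ideal_span {CR q 0}" for p q :: "'a poly"
  proof -
    have "CR q 0 \<in> ideal_span {CR p 0}"
      unfolding that by (simp add: ideal_span_base)
    then obtain k where "CR q 0 = k * CR p 0"
      by (auto simp: ideal_span_singleton)
    from arg_cong[OF this, of rpart] show ?thesis by simp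
  qed
  have p_dvd: "xdiff P * xdiff Q dvd cr_norm f" and n_dvd: "cr_norm f dvd xdiff P * xdiff Q"
    using dvd eq by metis+
  have n0: "cr_norm f \<noteq> 0" using f0 by (simp add: cr_norm_eq_0_iff)
  have deg: "degree (cr_norm f) = degree (xdiff P) + degree (xdiff Q)"
    using dvd_imp_degree_le[OF p_dvd n0] dvd_imp_degree_le[OF n_dvd]
    by (simp add: degree_mult_eq)
  have le1: "degree (xdiff R) \<le> 1" for R :: "'a ec_point" by (cases R) simp_all
  have "degree (cr_norm f) < 3"
    using deg le1[of P] le1[of Q] by simp
  then have y0: "ypart f = 0" using degree_cr_norm[of f] by force
  define A where "A = rpart f"
  have n: "cr_norm f = A ^ 2" by (simp add: cr_norm_def y0 A_def)
  have "A \<noteq> 0" using n n0 by auto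
  then have deg2: "2 * degree A = degree (xdiff P) + degree (xdiff Q)"
    using deg by (simp add: n degree_power_eq)
  \<comment> \<open>\<open>xdiff\<close> has degree 0 at \<open>Infinity\<close> and 1 elsewhere, so
    parity excludes the case of exactly one affine point.\<close>
  have par: "even (degree (xdiff P) + degree (xdiff Q))"
    using deg2 by (metis dvd_triv_left)
  show ?thesis
  proof (cases P; cases Q)
    fix u1 v1 u2 v2
    assume PQ: "P = Affine u1 v1" "Q = Affine u2 v2"
    have "degree A = 1" using deg2 by (simp add: PQ)
    then obtain c d where A: "A = [:c, d:]" and d: "d \<noteq> 0"
      by (metis degree_eq_zeroE degree_pCons_eq_if degree_0 One_nat_def pCons_cases nat.distinct(1) nat.inject pCons_0_0)
    have root: "poly A u1 = 0" "poly A u2 = 0"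
    proof -
      obtain k where "A ^ 2 = [:- u1, 1:] * [:- u2, 1:] * k"
        using p_dvd unfolding n PQ by auto
      from arg_cong[OF this, of "\<lambda>p. poly p u1"] arg_cong[OF this, of "\<lambda>p. poly p u2"]
      show "poly A u1 = 0" "poly A u2 = 0"
        by (simp_all add: poly_mult del: mult_pCons_left mult_pCons_right)
    qed
    \<comment> \<open>A linear polynomial has only one root, so the abscissas coincide.\<close>
    have "c + u1 * d = c + u2 * d" using root unfolding A by simp
    with d have u: "u1 = u2" by simp
    show ?thesis
    proof (cases "v1 = v2")
      case False
      have "(v1 - v2) * (v1 + v2) = 0"
        using E u by (simp add: PQ algebra_simps power2_eq_square)
      with False have v: "v2 = - v1" by (simp add: add_eq_0_iff)
      \<comment> \<open>Now \<open>ec_neg Q = P\<close>. As \<open>f\<close> is a polynomial in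
        \<open>X\<close>, it divides the \<open>Y\<close>-coefficient \<open>- 2 * v1\<close> of
        this square; evaluating at the root \<open>u1\<close> of \<open>A\<close> gives
        \<open>v1 = 0\<close>.\<close>
      have "(Yc - cst v1) * (Yc - cst v1) \<in> ideal_span (gens P * gens (ec_neg Q))"
        by (intro ideal_span_base set_times_intro) (simp_all add: PQ v)
      then obtain k where k: "(Yc - cst v1) * (Yc - cst v1) = k * f"
        unfolding f by (auto simp: ideal_span_singleton)
      have "[:- 2 * v1:] = ypart k * A"
        using arg_cong[OF k, of ypart] by (simp add: y0 A_def Yc_def cst_def)
      from arg_cong[OF this, of "\<lambda>p. poly p u1"] root have "v1 = 0" by simp
      with False v show ?thesis by simp
    qed (simp add: PQ u)
  qed (use par in auto)
qed

lemma ec_add_assoc: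
  fixes P Q R :: "'a::field_char_0 ec_point"
  assumes "P \<in> E" "Q \<in> E" "R \<in> E"
  shows "ec_add 0 (ec_add 0 P Q) R = ec_add 0 P (ec_add 0 Q R)"
proof (rule gens_inj)
  have "same_class (gens (ec_add 0 (ec_add 0 P Q) R)) (gens (ec_add 0 P Q) * gens R)"
    by (rule same_class_sym, rule gens_add_same_class) (use assms in \<open>simp_all add: ec_add_in_E\<close>)
  also have "same_class \<dots> ((gens P * gens Q) * gens R)"
    by (rule same_class_sym, rule same_class_times_right, rule gens_add_same_class) (use assms in simp_all)
  also have "(gens P * gens Q) * gens R = (gens Q * gens R) * gens P"
    by (simp only: mult_ac)
  also have "same_class \<dots> (gens (ec_add 0 Q R) * gens P)"
    by (rule same_class_times_right, rule gens_add_same_class) (use assms in simp_all)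
  also have "gens (ec_add 0 Q R) * gens P = gens P * gens (ec_add 0 Q R)"
    by (rule mult.commute)
  also have "same_class \<dots> (gens (ec_add 0 P (ec_add 0 Q R)))"
    by (rule gens_add_same_class) (use assms in \<open>simp_all add: ec_add_in_E\<close>)
  finally show "same_class (gens (ec_add 0 (ec_add 0 P Q) R)) (gens (ec_add 0 P (ec_add 0 Q R)))" .
qed (use assms in \<open>simp_all add: ec_add_in_E\<close>)

lemma ec_add_commute:
  fixes P Q :: "'a::field_char_0 ec_point"
  assumes "P \<in> E" "Q \<in> E"
  shows "ec_add 0 P Q = ec_add 0 Q P"
proof (rule gens_inj)
  have "same_class (gens (ec_add 0 P Q)) (gens P * gens Q)"
    by (rule same_class_sym, rule gens_add_same_class[OF assms])
  moreover have "same_class (gens P * gens Q) (gens (ec_add 0 Q P))"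
    unfolding mult.commute[of "gens P"] by (rule gens_add_same_class[OF assms(2,1)])
  ultimately show "same_class (gens (ec_add 0 P Q)) (gens (ec_add 0 Q P))"
    by (rule same_class_trans)
qed (use assms in \<open>simp_all add: ec_add_in_E\<close>)

lemma comm_group_ec_group: "comm_group (ec_group (0::'a::field_char_0) 1)"
proof (rule comm_groupI)
  fix P assume "P \<in> carrier (ec_group (0::'a) 1)"
  then have "ec_neg P \<in> E" "ec_add 0 (ec_neg P) P = Infinity"
    by (auto simp: ec_group_def) (cases P; simp)
  then show "\<exists>Q\<in>carrier (ec_group 0 1). Q \<otimes>\<^bsub>ec_group 0 1\<^esub> P = \<one>\<^bsub>ec_group (0::'a) 1\<^esub>"
    by (auto simp: ec_group_def)
qed (simp_all add: ec_group_def ec_add_in_E ec_add_assoc, rule ec_add_commute)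

section \<open>Heights and duplication\<close>

definition height :: "rat \<Rightarrow> int" where
  "height q = max \<bar>fst (quotient_of q)\<bar> (snd (quotient_of q))"

text \<open>The \<open>x\<close>-coordinate of \<open>2 P\<close> in terms of that of \<open>P\<close>.\<close>

definition dup :: "'a::field \<Rightarrow> 'a" where
  "dup x = x * (x ^ 3 - 8) / (4 * (x ^ 3 + 1))"

text \<open>These are numerator and denominator of \<open>dup (a / b)\<close>. Modulo
  \<open>b\<close> the numerator is \<open>a ^ 4\<close>, so the gcd \<open>d\<close> is prime to
  \<open>b\<close>. Eliminating the leading terms shows that \<open>d\<close> divides
  \<open>36 * a * b ^ 3\<close>, hence \<open>36 * a\<close>, and a second elimination leaves
  \<open>36 * b ^ 3\<close>.\<close>

lemma gcd_dup_dvd: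
  fixes a b :: int
  assumes "coprime a b"
  shows "gcd (a * (a ^ 3 - 8 * b ^ 3)) (4 * b * (a ^ 3 + b ^ 3)) dvd 36"
proof -
  define d where "d = gcd (a * (a ^ 3 - 8 * b ^ 3)) (4 * b * (a ^ 3 + b ^ 3))"
  have d1: "d dvd a * (a ^ 3 - 8 * b ^ 3)" and d2: "d dvd 4 * b * (a ^ 3 + b ^ 3)"
    by (simp_all add: d_def)
  have "coprime (a * (a ^ 3 - 8 * b ^ 3)) b"
  proof (rule coprimeI)
    fix c assume c: "c dvd a * (a ^ 3 - 8 * b ^ 3)" "c dvd b"
    have "a ^ 4 = a * (a ^ 3 - 8 * b ^ 3) + b * (8 * a * b ^ 2)"
      by (simp add: algebra_simps power2_eq_square power3_eq_cube power4_eq_xxxx)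
    with c have "c dvd a ^ 4" by (metis dvd_add dvd_mult2)
    moreover have "coprime (a ^ 4) b" using assms by simp
    ultimately show "is_unit c" using c(2) by (meson coprime_common_divisor)
  qed
  then have db: "coprime d b"
    using d1 by (meson coprime_divisors dvd_refl)
  have "d dvd b * (4 * (a ^ 3 + b ^ 3))" using d2 by (simp add: mult_ac)
  with db have d4: "d dvd 4 * (a ^ 3 + b ^ 3)" by (simp add: coprime_dvd_mult_right_iff)
  have "a * (4 * (a ^ 3 + b ^ 3)) - 4 * (a * (a ^ 3 - 8 * b ^ 3)) = b ^ 3 * (36 * a)"
    by (simp add: algebra_simps)
  then have "d dvd b ^ 3 * (36 * a)"
    using d1 d4 by (metis dvd_diff dvd_mult)
  with db have d36a: "d dvd 36 * a" by (simp add: coprime_dvd_mult_right_iff)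
  have "9 * (4 * (a ^ 3 + b ^ 3)) - a ^ 2 * (36 * a) = b ^ 3 * 36"
    by (simp add: algebra_simps power2_eq_square power3_eq_cube)
  then have "d dvd b ^ 3 * 36"
    using d36a d4 by (metis dvd_diff dvd_mult)
  with db show ?thesis unfolding d_def[symmetric] by (simp add: coprime_dvd_mult_right_iff)
qed

text \<open>Reducing \<open>N / M\<close> to lowest terms cancels a common factor \<open>k\<close>,
  whose absolute value is at most \<open>g\<close>.\<close>

lemma height_fraction_ge:
  fixes N M g :: int
  assumes q: "q = of_int N / of_int M" and M: "M \<noteq> 0" and g: "gcd N M dvd g" "g > 0"
  shows "max \<bar>N\<bar> \<bar>M\<bar> \<le> g * height q"
proof -
  obtain a b where ab: "quotient_of q = (a, b)" by (cases "quotient_of q")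
  have b: "b > 0" and cop: "coprime a b" and qab: "q = of_int a / of_int b"
    using quotient_of_denom_pos[OF ab] quotient_of_coprime[OF ab] quotient_of_div[OF ab] by auto
  have "of_int (a * M) = (of_int (N * b) :: rat)"
    using q qab M b by (simp add: field_simps)
  then have eq: "a * M = N * b" by (simp only: of_int_eq_iff)
  then have "b dvd a * M" by simp
  then have "b dvd M"
    using cop by (simp add: coprime_commute coprime_dvd_mult_right_iff)
  then obtain k where k: "M = b * k" by blast
  with eq b have k': "N = a * k" by simp
  from k k' have "k dvd gcd N M" by simp
  with g have "\<bar>k\<bar> \<le> g" by (meson dvd_trans dvd_imp_le_int zdvd_imp_le abs_dvd_iff)
  moreover have "\<bar>N\<bar> \<le> height q * \<bar>k\<bar>" "\<bar>M\<bar> \<le> height q * \<bar>k\<bar>"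
    using b by (auto simp: height_def ab k k' abs_mult intro!: mult_right_mono)
  moreover have "height q \<ge> 0" using b by (simp add: height_def ab)
  ultimately show ?thesis
    by (smt (verit) mult.commute mult_left_mono)
qed

text \<open>The two quartic forms cannot both be small. If \<open>\<bar>b\<bar> = h\<close>, the
  factor \<open>a ^ 3 + b ^ 3\<close> is large for \<open>2 * \<bar>a\<bar> \<le> h\<close>, and
  \<open>a ^ 3 - 8 * b ^ 3\<close> otherwise. If \<open>\<bar>a\<bar> = h\<close>, the factor
  \<open>a ^ 3 - 8 * b ^ 3\<close> is large for \<open>4 * \<bar>b\<bar> \<le> h\<close>; otherwise
  one of the two factors is at least \<open>h ^ 3\<close> in absolute value, depending on the
  signs.\<close>

lemma dup_lower_bound:
  fixes a b h :: int
  assumes h: "h = max \<bar>a\<bar> \<bar>b\<bar>"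
  shows "7 * h ^ 4 \<le> 8 * max \<bar>a * (a ^ 3 - 8 * b ^ 3)\<bar> \<bar>4 * b * (a ^ 3 + b ^ 3)\<bar>"
proof -
  define x y where "x = \<bar>a\<bar>" and "y = \<bar>b\<bar>"
  have xy: "x \<ge> 0" "y \<ge> 0" "x \<le> h" "y \<le> h" "x = h \<or> y = h" "h \<ge> 0"
    using h by (auto simp: x_def y_def)
  have c: "x ^ 3 = \<bar>a ^ 3\<bar>" "y ^ 3 = \<bar>b ^ 3\<bar>" by (simp_all add: x_def y_def power_abs)
  define n m where "n = \<bar>a ^ 3 - 8 * b ^ 3\<bar>" and "m = \<bar>a ^ 3 + b ^ 3\<bar>"
  have n: "n \<ge> x ^ 3 - 8 * y ^ 3" "n \<ge> 8 * y ^ 3 - x ^ 3" and m: "m \<ge> y ^ 3 - x ^ 3" and nm: "n \<ge> 0" "m \<ge> 0"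
    and nm': "n \<ge> x ^ 3 \<or> m \<ge> x ^ 3"
    unfolding n_def m_def c by linarith+
  have N: "\<bar>a * (a ^ 3 - 8 * b ^ 3)\<bar> = x * n" and M: "\<bar>4 * b * (a ^ 3 + b ^ 3)\<bar> = 4 * y * m"
    by (simp_all add: x_def y_def n_def m_def abs_mult)
  have h4: "h ^ 4 = h * h ^ 3" by (simp add: power_numeral_reduce)
  have x3: "x ^ 3 \<le> h ^ 3" and h3: "h ^ 3 \<ge> 0" "x ^ 3 \<ge> 0" "y ^ 3 \<ge> 0"
    using xy by (simp_all add: power_mono)
  have "7 * h ^ 4 \<le> 8 * (x * n) \<or> 7 * h ^ 4 \<le> 8 * (4 * y * m)"
  proof (cases "y = h")
    case True
    show ?thesis
    proof (cases "2 * x \<le> h")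
      case small: True
      have "(2 * x) ^ 3 \<le> h ^ 3" using small xy by (intro power_mono) auto
      then have "8 * x ^ 3 \<le> h ^ 3" by (simp add: power_mult_distrib)
      then have "7 * h ^ 3 \<le> 32 * m" using m h3 unfolding True by linarith
      from mult_left_mono[OF this xy(6)] show ?thesis
        using True by (simp add: h4 algebra_simps)
    next
      case False
      have "7 * h ^ 3 \<le> n" using n(2) True x3 by simp
      from mult_mono[OF _ this, of h "2 * x"] False xy h3 nm have "h * (7 * h ^ 3) \<le> 2 * x * n" by simp
      moreover have "0 \<le> x * n" using xy nm by simp
      ultimately have "7 * h ^ 4 \<le> 8 * (x * n)" by (simp add: h4)
      then show ?thesis ..
    qed
  next
    case False
    with xy have xh: "x = h" by blast
    show ?thesis
    proof (cases "4 * y \<le> h")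
      case small: True
      have "(4 * y) ^ 3 \<le> h ^ 3" using small xy by (intro power_mono) auto
      then have "64 * y ^ 3 \<le> h ^ 3" by (simp add: power_mult_distrib)
      then have "7 * h ^ 3 \<le> 8 * n" using n(1) xh by simp
      from mult_left_mono[OF this xy(6)] show ?thesis
        using xh by (simp add: h4 algebra_simps)
    next
      case big: False
      from nm' show ?thesis
      proof
        assume "x ^ 3 \<le> n"
        from mult_left_mono[OF this xy(6)] have "h ^ 4 \<le> x * n" using xh by (simp add: h4)
        moreover have "0 \<le> h ^ 4" by simp
        ultimately show ?thesis by linarith
      next
        assume "x ^ 3 \<le> m"
        then have "h ^ 3 \<le> m" using xh by simp
        from mult_mono[OF _ this, of h "4 * y"] big xy h3 nm have "h ^ 4 \<le> 4 * y * m" by (simp add: h4)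
        moreover have "0 \<le> h ^ 4" by simp
        ultimately show ?thesis by linarith
      qed
    qed
  qed
  then show ?thesis unfolding N M by linarith
qed

text \<open>Cancelling at most 36 from the lower bound leaves
  \<open>7 * h ^ 4 \<le> 288 * height (dup q)\<close> for the height \<open>h\<close> of
  \<open>q\<close>. With \<open>h ^ 3 \<ge> 64\<close> this reads
  \<open>448 * h \<le> 288 * height (dup q)\<close>.\<close>

lemma height_dup_gt:
  assumes "height q \<ge> 4"
  shows "height (dup q) > height q"
proof -
  obtain a b where ab: "quotient_of q = (a, b)" by (cases "quotient_of q")
  have b: "b > 0" and cop: "coprime a b" and qab: "q = of_int a / of_int b"
    using quotient_of_denom_pos[OF ab] quotient_of_coprime[OF ab] quotient_of_div[OF ab] by auto
  have h: "height q = max \<bar>a\<bar> \<bar>b\<bar>" using b by (simp add: height_def ab)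
  let ?N = "a * (a ^ 3 - 8 * b ^ 3)" and ?M = "4 * b * (a ^ 3 + b ^ 3)"
  \<comment> \<open>In lowest terms a zero of the denominator forces
    \<open>\<bar>a\<bar> = \<bar>b\<bar> = 1\<close>, that is height 1.\<close>
  have "a ^ 3 + b ^ 3 \<noteq> 0"
  proof
    assume "a ^ 3 + b ^ 3 = 0"
    then have "a ^ 3 = - (b ^ 3)" by (simp only: eq_neg_iff_add_eq_0)
    then have "\<bar>a\<bar> ^ 3 = \<bar>b\<bar> ^ 3" by (simp only: power_abs[symmetric] abs_minus_cancel)
    then have "\<bar>a\<bar> = \<bar>b\<bar>"
      by (rule power_eq_imp_eq_base) simp_all
    moreover from this have "b dvd a" by (auto simp: abs_eq_iff)
    from coprime_common_divisor[OF cop this dvd_refl] have "\<bar>b\<bar> = 1" by simp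
    ultimately show False using h assms by simp
  qed
  with b have M: "?M \<noteq> 0" by simp
  have "dup q = of_int ?N / of_int ?M"
  proof -
    have "(of_int a :: rat) ^ 3 + of_int b ^ 3 \<noteq> 0"
      using \<open>a ^ 3 + b ^ 3 \<noteq> 0\<close> by (simp flip: of_int_power of_int_add)
    then show ?thesis
      using b by (simp add: dup_def qab divide_simps)
  qed
  from height_fraction_ge[OF this M gcd_dup_dvd[OF cop]]
  have "max \<bar>?N\<bar> \<bar>?M\<bar> \<le> 36 * height (dup q)" by simp
  with dup_lower_bound[OF h] have "7 * height q ^ 4 \<le> 288 * height (dup q)" by linarith
  moreover have "64 * height q \<le> height q ^ 4"
  proof -
    have "(4::int) ^ 3 \<le> height q ^ 3" using assms by (intro power_mono) auto
    then have "height q * 64 \<le> height q * height q ^ 3"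
      using assms by (intro mult_left_mono) auto
    then show ?thesis by (simp add: power_numeral_reduce)
  qed
  ultimately show ?thesis using assms by linarith
qed

text \<open>A height below 4 leaves the finitely many fractions with
  \<open>\<bar>a\<bar> \<le> 3\<close> and \<open>1 \<le> b \<le> 3\<close>, which are checked by
  evaluation. The exceptions are the abscissas of the nonzero multiples of
  \<open>(2, 3)\<close>.\<close>

lemma height_dup_small:
  assumes "height q < 4" "q \<notin> {-1, 0, 2}"
  shows "height (dup q) \<ge> 4"
proof -
  have *: "\<forall>a\<in>set [-3..3]. \<forall>b\<in>set [1..3]. Fract a b \<in> {-1, 0, 2} \<or> height (dup (Fract a b)) \<ge> 4"
    by code_simp
  obtain a b where ab: "quotient_of q = (a, b)" by (cases "quotient_of q")
  then have "b > 0" by (rule quotient_of_denom_pos)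
  then have "a \<in> set [-3..3]" "b \<in> set [1..3]" "q = Fract a b"
    using assms(1) ab Fract_quotient_of[of q] by (auto simp: height_def)
  with * assms(2) show ?thesis by blast
qed

section \<open>Torsion points with rational abscissa\<close>

lemma (in comm_group) torsion_elements_mult:
  assumes "x \<in> torsion_elements G" "y \<in> torsion_elements G"
  shows "x \<otimes> y \<in> torsion_elements G"
proof -
  from assms obtain m n :: nat where x: "x \<in> carrier G" "m > 0" "x [^] m = \<one>"
    and y: "y \<in> carrier G" "n > 0" "y [^] n = \<one>"
    unfolding torsion_elements_def by blast
  have "x [^] (m * n) = \<one>" using x by (simp add: nat_pow_pow[symmetric])
  moreover have "y [^] (m * n) = \<one>"
    using y by (simp add: nat_pow_pow[symmetric] mult.commute[of m])
  ultimately have "(x \<otimes> y) [^] (m * n) = \<one>" using x y by (simp add: nat_pow_distrib)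
  then show ?thesis
    using x y unfolding torsion_elements_def by (auto intro!: exI[of _ "m * n"])
qed

lemma (in group) nat_pow_mod:
  assumes "x \<in> carrier G" "x [^] (n::nat) = \<one>"
  shows "x [^] (k mod n) = x [^] k"
proof -
  have "x [^] k = x [^] (n * (k div n) + k mod n)" by simp
  also have "\<dots> = (x [^] n) [^] (k div n) \<otimes> x [^] (k mod n)"
    using assms(1) by (simp only: nat_pow_mult[symmetric] nat_pow_pow)
  finally show ?thesis using assms by simp
qed

lemma (in group) finite_powers_torsion:
  assumes "x \<in> torsion_elements G"
  shows "finite (range (\<lambda>k::nat. x [^] k))"
proof -
  from assms obtain n :: nat where x: "x \<in> carrier G" "n > 0" "x [^] n = \<one>"
    unfolding torsion_elements_def by blast
  have "range (\<lambda>k::nat. x [^] k) \<subseteq> (\<lambda>k. x [^] k) ` {..<n}"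
  proof
    fix z assume "z \<in> range (\<lambda>k::nat. x [^] k)"
    then obtain k where "z = x [^] (k mod n)" using nat_pow_mod[OF x(1,3)] by auto
    with x(2) show "z \<in> (\<lambda>k. x [^] k) ` {..<n}" by auto
  qed
  then show ?thesis by (rule finite_subset) simp
qed

abbreviation EG :: "'a::field_char_0 ec_point monoid" where
  "EG \<equiv> ec_group 0 1"

interpretation EG: comm_group "EG :: 'a::field_char_0 ec_point monoid"
  by (rule comm_group_ec_group)

lemma EG_simps: "carrier EG = E" "P \<otimes>\<^bsub>EG\<^esub> Q = ec_add 0 P Q" "\<one>\<^bsub>EG\<^esub> = Infinity"
  by (simp_all add: ec_group_def)

lemma inv_EG:
  assumes "P \<in> E"
  shows "inv\<^bsub>EG\<^esub> P = ec_neg P"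
  by (rule EG.inv_equality; cases P; use assms in \<open>simp add: EG_simps\<close>)

lemma ec_add_double:
  fixes x y :: "'a::field_char_0"
  assumes "Affine x y \<in> E" "y \<noteq> 0"
  shows "\<exists>y'. ec_add 0 (Affine x y) (Affine x y) = Affine (dup x) (y' :: 'a)"
proof -
  have y: "y ^ 2 = x ^ 3 + 1" using assms by simp
  have n0: "x ^ 3 + 1 \<noteq> 0" using assms(2) unfolding y[symmetric] by simp
  have "(3 * x ^ 2 / (2 * y)) ^ 2 - x - x = 9 * x ^ 4 / (4 * (x ^ 3 + 1)) - 2 * x"
    unfolding y[symmetric] by (simp add: power_divide power_mult_distrib flip: power_mult)
  also have "\<dots> = dup x"
  proof -
    have "9 * x ^ 4 - 2 * x * (4 * (x ^ 3 + 1)) = x * (x ^ 3 - 8)"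
      by (simp add: algebra_simps power3_eq_cube power4_eq_xxxx)
    moreover have "9 * x ^ 4 / (4 * (x ^ 3 + 1)) - 2 * x
        = (9 * x ^ 4 - 2 * x * (4 * (x ^ 3 + 1))) / (4 * (x ^ 3 + 1))"
    proof -
      have "4 * (x ^ 3 + 1) \<noteq> 0" using n0 by (simp only: mult_eq_0_iff) simp
      from nonzero_mult_div_cancel_right[OF this] show ?thesis by (simp only: diff_divide_distrib)
    qed
    ultimately show ?thesis by (simp only: dup_def)
  qed
  finally show ?thesis using assms(2) by (simp add: Let_def)
qed

lemma of_rat_dup: "dup (of_rat q :: 'a::field_char_0) = of_rat (dup q)"
  by (simp add: dup_def of_rat_divide of_rat_mult of_rat_add of_rat_diff of_rat_power)

lemma rat_cube_eq_minus_1: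
  assumes "q ^ 3 + 1 = (0::rat)"
  shows "q = - 1"
proof -
  have "(q + 1) * ((q - 1 / 2) ^ 2 + 3 / 4) = 0"
    using assms by (simp add: algebra_simps power2_eq_square power3_eq_cube)
  moreover have "(q - 1 / 2) ^ 2 + 3 / 4 > 0"
    by (simp add: add_nonneg_pos)
  ultimately have "q + 1 = 0" by simp
  then show ?thesis by (simp add: add_eq_0_iff)
qed

lemma ec_add_double_of_rat:
  assumes "Affine (of_rat q) (y::'a::field_char_0) \<in> E" "q \<noteq> - 1"
  shows "\<exists>y'. ec_add 0 (Affine (of_rat q) y) (Affine (of_rat q) y) = Affine (of_rat (dup q) :: 'a) y'"
proof -
  have "of_rat (q ^ 3 + 1) \<noteq> (0::'a)"
    using assms(2) rat_cube_eq_minus_1[of q] by (simp only: of_rat_eq_0_iff) blast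
  then have "y ^ 2 \<noteq> 0" using assms(1) by (simp add: of_rat_add of_rat_power)
  then show ?thesis
    using ec_add_double[OF assms(1)] by (simp add: of_rat_dup)
qed

text \<open>From height 4 on, repeated doubling would produce abscissas of unbounded height, while a
  torsion point has only finitely many multiples.\<close>

lemma torsion_height_less_4:
  assumes P: "Affine (of_rat q) (y::'a::field_char_0) \<in> torsion_elements EG"
  shows "height q < 4"
proof (rule ccontr)
  assume "\<not> height q < 4"
  then have q: "height q \<ge> 4" by simp
  let ?P = "Affine (of_rat q) y"
  have PE: "?P \<in> carrier EG" using P by (simp add: torsion_elements_def)
  have grow: "\<exists>r z. ?P [^]\<^bsub>EG\<^esub> (2 ^ k :: nat) = Affine (of_rat r) z \<and> height r \<ge> 4 + int k" for k
  proof (induction k)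
    case 0
    show ?case using q EG.nat_pow_Suc[of ?P 0] EG.l_one[OF PE] by (auto simp: EG_simps)
  next
    case (Suc k)
    then obtain r z where rz: "?P [^]\<^bsub>EG\<^esub> (2 ^ k :: nat) = Affine (of_rat r) z" "height r \<ge> 4 + int k"
      by blast
    have "Affine (of_rat r) z \<in> E"
      using EG.nat_pow_closed[OF PE, of "2 ^ k"] unfolding rz EG_simps .
    moreover have "r \<noteq> - 1" using rz(2) by (auto simp: height_def)
    ultimately obtain z' where z': "ec_add 0 (Affine (of_rat r) z) (Affine (of_rat r) z)
        = Affine (of_rat (dup r)) z'"
      using ec_add_double_of_rat by blast
    have "?P [^]\<^bsub>EG\<^esub> (2 ^ Suc k :: nat)
        = ?P [^]\<^bsub>EG\<^esub> (2 ^ k :: nat) \<otimes>\<^bsub>EG\<^esub> ?P [^]\<^bsub>EG\<^esub> (2 ^ k :: nat)"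
      using PE by (simp only: EG.nat_pow_mult power_Suc mult_2)
    also have "\<dots> = Affine (of_rat (dup r)) z'" unfolding rz EG_simps z' ..
    finally show ?case using height_dup_gt[of r] rz(2) by fastforce
  qed
  \<comment> \<open>On irrational abscissas \<open>H\<close> takes an arbitrary value; only its
    boundedness on a finite set and its value on rational abscissas matter.\<close>
  define H :: "'a ec_point \<Rightarrow> int" where
    "H R = (case R of Infinity \<Rightarrow> 0 | Affine x _ \<Rightarrow> height (inv_into UNIV of_rat x))" for R
  have inv: "inv_into UNIV of_rat (of_rat r :: 'a) = r" for r
    by (rule inv_f_f) (simp add: inj_def)
  have "finite (H ` range (\<lambda>k::nat. ?P [^]\<^bsub>EG\<^esub> k))"
    using EG.finite_powers_torsion[OF P] by simp
  then obtain B where B: "H (?P [^]\<^bsub>EG\<^esub> (k::nat)) \<le> B" for k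
    by (metis (no_types, lifting) Max_ge rangeI imageI)
  obtain r z where "?P [^]\<^bsub>EG\<^esub> (2 ^ nat \<bar>B\<bar> :: nat) = Affine (of_rat r) z" "height r \<ge> 4 + int (nat \<bar>B\<bar>)"
    using grow by blast
  with B[of "2 ^ nat \<bar>B\<bar>"] show False by (simp add: H_def inv)
qed

text \<open>The bound 4 applies both to the point and to its double, but any other abscissa of
  height below 4 doubles to one of height at least 4.\<close>

lemma torsion_rational_x:
  assumes P: "Affine (of_rat q) (y::'a::field_char_0) \<in> torsion_elements EG"
  shows "q \<in> {-1, 0, 2}"
proof (rule ccontr)
  assume q: "q \<notin> {-1, 0, 2}"
  let ?P = "Affine (of_rat q) y"
  have "?P \<in> E" using P by (simp add: torsion_elements_def EG_simps)
  with q obtain y' where "?P \<otimes>\<^bsub>EG\<^esub> ?P = Affine (of_rat (dup q)) y'"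
    unfolding EG_simps using ec_add_double_of_rat by blast
  with EG.torsion_elements_mult[OF P P] have "height (dup q) < 4"
    using torsion_height_less_4 by metis
  with height_dup_small[OF torsion_height_less_4[OF P] q] show False by simp
qed

section \<open>Quadratic fields\<close>

definition is_conjugation :: "('a::field_char_0 \<Rightarrow> 'a) \<Rightarrow> bool" where
  "is_conjugation \<sigma> \<longleftrightarrow> (\<forall>x y. \<sigma> (x + y) = \<sigma> x + \<sigma> y \<and> \<sigma> (x * y) = \<sigma> x * \<sigma> y) \<and>
    (\<forall>x. \<sigma> (\<sigma> x) = x) \<and> (\<forall>x. \<sigma> x = x \<longleftrightarrow> x \<in> range of_rat)"

lemma is_conjugationD:
  assumes "is_conjugation \<sigma>"
  shows "\<sigma> (x + y) = \<sigma> x + \<sigma> y" "\<sigma> (x * y) = \<sigma> x * \<sigma> y" "\<sigma> (\<sigma> x) = x"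
    "\<sigma> x = x \<Longrightarrow> x \<in> range of_rat" "\<sigma> (of_rat q) = of_rat q"
  using assms by (auto simp: is_conjugation_def)

text \<open>Completing the square gives \<open>K = Q(w)\<close> with \<open>w\<close> irrational and
  \<open>w * w\<close> rational; the conjugation is \<open>a + b w -> a - b w\<close>.\<close>

lemma quadratic_conjugation:
  assumes "quadratic_field TYPE('a::field_char_0)"
  obtains \<sigma> :: "'a::field_char_0 \<Rightarrow> 'a" where "is_conjugation \<sigma>"
proof -
  interpret V: vector_space "\<lambda>(q::rat) (x::'a). of_rat q * x"
    by (rule vector_space_of_rat)
  have dim: "V.dim (UNIV :: 'a set) = 2" using assms by (simp add: quadratic_field_def)
  obtain B where B: "V.independent B" "UNIV \<subseteq> V.span B" "card B = 2"
    using V.basis_exists[of UNIV] dim by metis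
  have finB: "finite B" using B(3) by (simp add: card_ge_0_finite)
  have span1: "z \<in> V.span {1} \<longleftrightarrow> z \<in> range of_rat" for z :: 'a
    by (simp add: V.span_singleton)
  obtain w0 :: 'a where w0: "w0 \<notin> range of_rat"
  proof -
    have "\<not> UNIV \<subseteq> V.span {1}"
      using V.dim_le_card[of UNIV "{1}"] dim by auto
    with span1 that show ?thesis by blast
  qed
  \<comment> \<open>An element outside this span would give three independent vectors in dimension
    2.\<close>
  have spans: "z \<in> V.span {1, w0}" for z
  proof (rule ccontr)
    assume z: "z \<notin> V.span {1, w0}"
    have "V.independent {1}" by (simp add: V.dependent_single V.independent_empty)
    then have "V.independent {w0, 1}"
      using w0 span1 by (intro V.independent_insertI) (auto simp: V.independent_empty)
    then have "V.independent {z, 1, w0}"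
      using z unfolding insert_commute[of w0 1] by (rule V.independent_insertI[rotated])
    from V.independent_span_bound[OF finB this] B(2,3)
    have "card {z, 1, w0} \<le> 2" by auto
    moreover have "z \<noteq> 1" "z \<noteq> w0" "w0 \<noteq> 1"
      using z w0 V.span_base[of _ "{1, w0}"] by (auto intro: range_eqI[of _ _ 1])
    ultimately show False by (simp add: card_insert_if)
  qed
  have repr: "\<exists>a b. z = of_rat a + of_rat b * w0" for z
  proof -
    obtain a where "z - of_rat a * 1 \<in> V.span {w0}"
      using spans[of z] V.span_breakdown_eq[of z 1 "{w0}"] by auto
    then obtain b where "z - of_rat a = of_rat b * w0" by (auto simp: V.span_singleton)
    then have "z = of_rat a + of_rat b * w0" by (simp add: diff_eq_eq add.commute)
    then show ?thesis by blast
  qed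
  obtain p q where pq: "w0 * w0 = of_rat p + of_rat q * w0" using repr by blast
  \<comment> \<open>Half the linear coefficient in \<open>w0 * w0 = p + q * w0\<close>; shifting by
    it removes the linear term and leaves \<open>d = p + h * h\<close>.\<close>
  define h where "h = q / 2"
  then have q: "q = 2 * h" by simp
  define w where "w = w0 - of_rat h"
  define d where "d = p + h * h"
  have ww: "w * w = of_rat d"
    by (simp add: w_def d_def algebra_simps pq q of_rat_add of_rat_mult)
  have w_irr: "w \<notin> range of_rat"
  proof
    assume "w \<in> range of_rat"
    then obtain r where "w = of_rat r" by blast
    then have "w0 = of_rat (r + h)" by (simp add: w_def of_rat_add diff_eq_eq)
    with w0 show False by blast
  qed
  have "\<exists>a b. z = of_rat a + of_rat b * w" for z
  proof -
    obtain a b where "z = of_rat a + of_rat b * w0" using repr by blast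
    then have "z = of_rat (a + b * h) + of_rat b * w"
      by (simp add: w_def of_rat_add of_rat_mult algebra_simps)
    then show ?thesis by blast
  qed
  then obtain \<alpha> \<beta> where ab: "z = of_rat (\<alpha> z) + of_rat (\<beta> z) * w" for z by metis
  have uniq: "a = a' \<and> b = b'"
    if "of_rat a + of_rat b * w = of_rat a' + of_rat b' * w" for a b a' b'
  proof -
    have eq: "of_rat (b - b') * w = of_rat (a' - a)"
      using that by (simp add: of_rat_diff algebra_simps)
    have "b = b'"
    proof (rule ccontr)
      assume "b \<noteq> b'"
      then have "of_rat (b - b') \<noteq> (0::'a)" by (simp only: of_rat_eq_0_iff)
      with eq have "w = of_rat ((a' - a) / (b - b'))"
        by (simp add: of_rat_divide eq_divide_eq mult.commute)
      with w_irr show False by blast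
    qed
    with that show ?thesis by simp
  qed
  define \<sigma> where "\<sigma> z = of_rat (\<alpha> z) - of_rat (\<beta> z) * w" for z
  have \<sigma>: "\<sigma> (of_rat a + of_rat b * w) = of_rat a - of_rat b * w" for a b
    using uniq[OF ab[of "of_rat a + of_rat b * w"]] by (simp add: \<sigma>_def)
  have hom: "\<sigma> (x + y) = \<sigma> x + \<sigma> y \<and> \<sigma> (x * y) = \<sigma> x * \<sigma> y" for x y
  proof -
    obtain a b c e where x: "x = of_rat a + of_rat b * w" and y: "y = of_rat c + of_rat e * w"
      using ab by blast
    have \<sigma>xy: "\<sigma> x = of_rat a - of_rat b * w" "\<sigma> y = of_rat c - of_rat e * w"
      unfolding x y by (rule \<sigma>)+
    have "x + y = of_rat (a + c) + of_rat (b + e) * w"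
      by (simp add: x y of_rat_add algebra_simps)
    then have "\<sigma> (x + y) = \<sigma> x + \<sigma> y"
      by (simp only: \<sigma> \<sigma>xy) (simp add: of_rat_add algebra_simps)
    moreover have "x * y = of_rat a * of_rat c + of_rat b * of_rat e * (w * w)
        + (of_rat a * of_rat e + of_rat b * of_rat c) * w"
      by (simp add: x y algebra_simps)
    then have "x * y = of_rat (a * c + b * e * d) + of_rat (a * e + b * c) * w"
      by (simp add: ww of_rat_add of_rat_mult)
    moreover have "(of_rat a - of_rat b * w) * (of_rat c - of_rat e * w)
        = of_rat a * of_rat c + of_rat b * of_rat e * (w * w)
        - (of_rat a * of_rat e + of_rat b * of_rat c) * w"
      by (simp add: algebra_simps)
    ultimately show ?thesis
      by (simp only: \<sigma> \<sigma>xy) (simp add: ww of_rat_add of_rat_mult)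
  qed
  have inv: "\<sigma> (\<sigma> x) = x" and fixed: "\<sigma> x = x \<longleftrightarrow> x \<in> range of_rat" for x
  proof -
    obtain a b where x: "x = of_rat a + of_rat b * w" using ab by blast
    have \<sigma>x: "\<sigma> x = of_rat a + of_rat (- b) * w" by (simp add: x \<sigma> of_rat_minus)
    show "\<sigma> (\<sigma> x) = x" unfolding \<sigma>x \<sigma> by (simp add: x of_rat_minus)
    have "\<sigma> (of_rat q) = of_rat q" for q using \<sigma>[of q 0] by simp
    moreover have "x \<in> range of_rat" if "\<sigma> x = x"
    proof -
      have "of_rat a + of_rat (- b) * w = of_rat a + of_rat b * w"
        using that unfolding \<sigma>x by (simp only: x)
      from uniq[OF this] have "b = 0" by simp
      then show ?thesis by (simp add: x)
    qed
    ultimately show "\<sigma> x = x \<longleftrightarrow> x \<in> range of_rat" by auto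
  qed
  from hom inv fixed show thesis by (intro that[of \<sigma>]) (simp add: is_conjugation_def)
qed

lemma rat_square_neq_12: "r ^ 2 \<noteq> (12::rat)"
proof
  assume r: "r ^ 2 = 12"
  obtain a b where ab: "quotient_of r = (a, b)" by (cases "quotient_of r")
  have b: "b > 0" and cop: "coprime a b" and rab: "r = of_int a / of_int b"
    using quotient_of_denom_pos[OF ab] quotient_of_coprime[OF ab] quotient_of_div[OF ab] by auto
  have "of_int (a ^ 2) = (of_int (12 * b ^ 2) :: rat)"
    using r b by (simp add: rab power_divide divide_eq_eq)
  then have eq: "a ^ 2 = 12 * b ^ 2" by (simp only: of_int_eq_iff)
  then have "b dvd a ^ 2" by (simp add: power2_eq_square)
  moreover have "coprime (a ^ 2) b" using cop by simp
  ultimately have "is_unit b" by (meson coprime_common_divisor dvd_refl)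
  with b eq have a: "\<bar>a\<bar> ^ 2 = 12" by simp
  show False
  proof (cases "\<bar>a\<bar> \<le> 3")
    case True
    then have "\<bar>a\<bar> ^ 2 \<le> 3 ^ 2" by (intro power_mono) auto
    with a show False by simp
  next
    case False
    then have "4 ^ 2 \<le> \<bar>a\<bar> ^ 2" by (intro power_mono) auto
    with a show False by simp
  qed
qed

text \<open>If \<open>R\<close> halves \<open>(-1, 0)\<close>, the tangent slope satisfies
  \<open>m ^ 2 = t - 3\<close> with \<open>t ^ 2 = 12\<close>. Conjugation sends \<open>t\<close> to
  \<open>- t\<close>, so the norm of \<open>m\<close> would be a rational number with square
  \<open>(t - 3) * (- t - 3) = - 3\<close>.\<close>

lemma ec_add_double_neq:
  assumes "quadratic_field TYPE('a::field_char_0)" "R \<in> E"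
  shows "ec_add 0 R R \<noteq> Affine (- 1) (0::'a)"
proof
  assume R2: "ec_add 0 R R = Affine (- 1) (0::'a)"
  obtain \<sigma> :: "'a \<Rightarrow> 'a" where conj: "is_conjugation \<sigma>"
    using quadratic_conjugation[OF assms(1)] .
  note \<sigma> = is_conjugationD[OF conj]
  obtain x y where R: "R = Affine x y" using R2 by (cases R) auto
  with assms(2) have xy: "y ^ 2 = x ^ 3 + 1" by simp
  have "y \<noteq> 0" using R2 R by auto
  then have "y \<noteq> - y" by (simp add: eq_neg_iff_add_eq_0)
  define m where "m = 3 * x ^ 2 / (2 * y)"
  have "ec_add 0 R R = Affine (m ^ 2 - x - x) (m * (x - (m ^ 2 - x - x)) - y)"
    using \<open>y \<noteq> - y\<close> by (simp add: R Let_def m_def)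
  from trans[OF this[symmetric] R2]
  have m1: "m ^ 2 - x - x = - 1" and m0: "m * (x - (m ^ 2 - x - x)) - y = 0"
    unfolding ec_point.inject by (rule conjunct1, rule conjunct2)
  from m1 m0[unfolded m1] have m2: "m ^ 2 = 2 * x - 1" and y: "y = m * (x + 1)" by (simp_all add: algebra_simps)
  have "x + 1 \<noteq> 0" using y \<open>y \<noteq> 0\<close> by auto
  \<comment> \<open>Both sides of \<open>(2 * x - 1) * (x + 1) ^ 2 = x ^ 3 + 1\<close> contain the
    factor \<open>x + 1\<close>, which is nonzero since \<open>y \<noteq> 0\<close>.\<close>
  moreover have "(x + 1) * ((x + 1) ^ 2 - 3) = 0"
    using xy m2 unfolding y by algebra
  ultimately have x3: "(x + 1) ^ 2 = 3" by simp
  define t where "t = 2 * x + 2"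
  have "t * t = 4 * (x + 1) ^ 2"
    by (simp add: t_def algebra_simps power2_eq_square)
  then have tt: "t * t = 12" unfolding x3 by simp
  have mm: "m * m = t - 3" using m2 by (simp add: t_def power2_eq_square)
  have num: "\<sigma> (numeral n) = numeral n" for n
    using \<sigma>(5)[of "numeral n"] by simp
  have "\<sigma> t * \<sigma> t = 12" using tt num \<sigma>(2) by metis
  with tt have "(\<sigma> t - t) * (\<sigma> t + t) = 0" by (simp add: algebra_simps)
  moreover have "\<sigma> t \<noteq> t"
  proof
    assume "\<sigma> t = t"
    then obtain r where "t = of_rat r" using \<sigma>(4) by blast
    with tt have "of_rat (r ^ 2) = (of_rat 12 :: 'a)"
      by (simp add: of_rat_mult power2_eq_square)
    then show False using rat_square_neq_12[of r] by (simp only: of_rat_eq_iff)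
  qed
  ultimately have \<sigma>t: "\<sigma> t = - t" by (simp add: eq_neg_iff_add_eq_0)
  have "\<sigma> (t - 3) + \<sigma> 3 = \<sigma> t" by (simp flip: \<sigma>(1))
  then have "\<sigma> (t - 3) = - t - 3" by (simp add: \<sigma>t num eq_diff_eq)
  then have \<sigma>m: "\<sigma> m * \<sigma> m = - t - 3" by (simp flip: \<sigma>(2) add: mm)
  have "\<sigma> (m * \<sigma> m) = m * \<sigma> m" by (simp add: \<sigma>(2,3) mult.commute)
  then obtain r where r: "m * \<sigma> m = of_rat r" using \<sigma>(4) by blast
  have "(m * \<sigma> m) * (m * \<sigma> m) = - 3" using mm \<sigma>m tt by algebra
  then have "of_rat (r * r) = (of_rat (- 3) :: 'a)"
    by (simp add: r of_rat_mult of_rat_minus)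
  then have "r * r = - 3" by (simp only: of_rat_eq_iff)
  moreover have "r * r \<ge> 0" by simp
  ultimately show False by simp
qed

section \<open>Multiples of (2, 3) and the action of conjugation on torsion points\<close>

lemma pow_Affine_2_3:
  defines "A \<equiv> Affine 2 3 :: 'a::field_char_0 ec_point"
  shows "A [^]\<^bsub>EG\<^esub> (0::nat) = Infinity" "A [^]\<^bsub>EG\<^esub> (1::nat) = Affine 2 3"
    "A [^]\<^bsub>EG\<^esub> (2::nat) = Affine 0 1" "A [^]\<^bsub>EG\<^esub> (3::nat) = Affine (- 1) 0"
    "A [^]\<^bsub>EG\<^esub> (4::nat) = Affine 0 (- 1)" "A [^]\<^bsub>EG\<^esub> (5::nat) = Affine 2 (- 3)"
    "A [^]\<^bsub>EG\<^esub> (6::nat) = Infinity"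
proof -
  have Suc: "A [^]\<^bsub>EG\<^esub> (Suc n) = ec_add 0 (A [^]\<^bsub>EG\<^esub> n) A" for n
    by (simp add: EG_simps)
  have neq: "(3::'a) \<noteq> - 3" by (simp add: eq_neg_iff_add_eq_0)
  show 0: "A [^]\<^bsub>EG\<^esub> (0::nat) = Infinity" by (simp add: EG_simps)
  show 1: "A [^]\<^bsub>EG\<^esub> (1::nat) = Affine 2 3"
    using Suc[of 0] 0 by (simp add: A_def)
  show 2: "A [^]\<^bsub>EG\<^esub> (2::nat) = Affine 0 1"
    using Suc[of 1] 1 neq by (simp add: A_def Let_def numeral_2_eq_2)
  show 3: "A [^]\<^bsub>EG\<^esub> (3::nat) = Affine (- 1) 0"
    using Suc[of 2] 2 by (simp add: A_def Let_def)
  have neq': "(- 1::'a) \<noteq> 2" by (simp add: neg_eq_iff_add_eq_0)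
  show 4: "A [^]\<^bsub>EG\<^esub> (4::nat) = Affine 0 (- 1)"
    using Suc[of 3] 3 neq' by (simp add: A_def Let_def)
  show 5: "A [^]\<^bsub>EG\<^esub> (5::nat) = Affine 2 (- 3)"
    using Suc[of 4] 4 by (simp add: A_def Let_def)
  show "A [^]\<^bsub>EG\<^esub> (6::nat) = Infinity"
    using Suc[of 5] 5 by (simp add: A_def)
qed

lemma Affine_2_3_in_EG: "Affine 2 3 \<in> carrier (EG :: 'a::field_char_0 ec_point monoid)"
  by (simp add: EG_simps)

text \<open>For each of the three possible abscissas, all solutions \<open>y\<close> already occur
  among the multiples of \<open>(2, 3)\<close>.\<close>

lemma torsion_rational_x_cases:
  assumes "Affine (of_rat q) (y::'a::field_char_0) \<in> torsion_elements EG"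
  shows "\<exists>i::nat. Affine (of_rat q) y = Affine 2 3 [^]\<^bsub>EG\<^esub> i"
proof -
  have y: "y ^ 2 = of_rat q ^ 3 + 1"
    using assms by (simp add: torsion_elements_def EG_simps)
  consider "q = - 1" | "q = 0" | "q = 2" using torsion_rational_x[OF assms] by blast
  then show ?thesis
  proof cases
    case 1
    with y have "y = 0" by (simp add: of_rat_minus)
    then show ?thesis using 1 pow_Affine_2_3(4) by (metis of_rat_minus of_rat_1)
  next
    case 2
    with y have "y ^ 2 = 1 ^ 2" by simp
    then have "y = 1 \<or> y = - 1" unfolding power2_eq_iff .
    then show ?thesis using 2 pow_Affine_2_3(3,5) by (metis of_rat_0)
  next
    case 3
    with y have "y ^ 2 = 3 ^ 2" by simp
    then have "y = 3 \<or> y = - 3" unfolding power2_eq_iff .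
    then show ?thesis using 3 pow_Affine_2_3(2,6) by (metis of_rat_numeral_eq)
  qed
qed

text \<open>The curve and the chord-tangent formulas have rational coefficients, so a field
  automorphism respects them, including their case distinctions.\<close>

lemma map_ec_point_add:
  fixes \<sigma> :: "'a::field_char_0 \<Rightarrow> 'a"
  assumes "is_conjugation \<sigma>"
  shows "map_ec_point \<sigma> (ec_add 0 P Q) = ec_add 0 (map_ec_point \<sigma> P) (map_ec_point \<sigma> Q)"
    and "map_ec_point \<sigma> P \<in> E \<longleftrightarrow> P \<in> E"
    and "map_ec_point \<sigma> (ec_neg P) = ec_neg (map_ec_point \<sigma> P)"
proof -
  note add = is_conjugationD(1)[OF assms] and mult = is_conjugationD(2)[OF assms]
    and inj = is_conjugationD(3)[OF assms] and rat = is_conjugationD(5)[OF assms]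
  have num: "\<sigma> 0 = 0" "\<sigma> 1 = 1" "\<sigma> (numeral n) = numeral n" for n
    using rat[of 0] rat[of 1] rat[of "numeral n"] by simp_all
  have minus: "\<sigma> (- x) = - \<sigma> x" for x
    using add[of x "- x"] num by (simp add: eq_neg_iff_add_eq_0 add.commute)
  have diff: "\<sigma> (x - y) = \<sigma> x - \<sigma> y" for x y
    using add[of x "- y"] minus by simp
  have eq: "\<sigma> x = \<sigma> y \<longleftrightarrow> x = y" for x y using inj by metis
  have eq0: "\<sigma> x = 0 \<longleftrightarrow> x = 0" for x using eq[of x 0] num by simp
  \<comment> \<open>The convention \<open>x / 0 = 0\<close> makes this hold for \<open>y = 0\<close>
    too.\<close>
  have div: "\<sigma> (x / y) = \<sigma> x / \<sigma> y" for x y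
  proof (cases "y = 0")
    case False
    then have "\<sigma> (x / y) * \<sigma> y = \<sigma> x" by (simp flip: mult)
    with False show ?thesis by (simp add: eq_divide_eq eq0)
  qed (simp add: num)
  have pow: "\<sigma> (x ^ n) = \<sigma> x ^ n" for x and n :: nat
    by (induction n) (simp_all add: num mult)
  note hom = add mult num minus diff div pow
  show "map_ec_point \<sigma> (ec_neg P) = ec_neg (map_ec_point \<sigma> P)"
    by (cases P) (simp_all add: minus)
  show "map_ec_point \<sigma> P \<in> E \<longleftrightarrow> P \<in> E"
  proof (cases P)
    case (Affine x y)
    have "y ^ 2 = x ^ 3 + 1 \<longleftrightarrow> \<sigma> (y ^ 2) = \<sigma> (x ^ 3 + 1)" by (simp only: eq)
    then show ?thesis by (simp add: Affine hom)
  qed simp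
  show "map_ec_point \<sigma> (ec_add 0 P Q) = ec_add 0 (map_ec_point \<sigma> P) (map_ec_point \<sigma> Q)"
  proof (cases P; cases Q)
    fix x1 y1 x2 y2
    assume PQ: "P = Affine x1 y1" "Q = Affine x2 y2"
    have "\<sigma> y1 = - \<sigma> y2 \<longleftrightarrow> y1 = - y2" by (simp flip: minus add: eq)
    then show ?thesis by (simp add: PQ Let_def hom eq)
  qed simp_all
qed

text \<open>With \<open>\<sigma>\<close> the conjugation of \<open>K\<close>, the points \<open>P + \<sigma> P\<close> and \<open>P - \<sigma> P\<close> are torsion points with
  rational \<open>x\<close>-coordinate, and their sum is \<open>2 P\<close>.\<close>

lemma torsion_double:
  assumes K: "quadratic_field TYPE('a::field_char_0)"
    and P: "(P :: 'a ec_point) \<in> torsion_elements EG"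
  shows "\<exists>i::nat. P \<otimes>\<^bsub>EG\<^esub> P = Affine 2 3 [^]\<^bsub>EG\<^esub> i"
proof -
  obtain \<sigma> :: "'a \<Rightarrow> 'a" where conj: "is_conjugation \<sigma>"
    using quadratic_conjugation[OF K] .
  note \<sigma> = is_conjugationD[OF conj]
  let ?s = "map_ec_point \<sigma>"
  note s = map_ec_point_add[OF conj]
  have ss: "?s (?s Q) = Q" for Q by (cases Q) (simp_all add: \<sigma>(3))
  obtain n :: nat where PE: "P \<in> E" and n: "n > 0" "P [^]\<^bsub>EG\<^esub> n = Infinity"
    using P by (auto simp: torsion_elements_def EG_simps)
  have sE: "?s P \<in> E" using PE by (simp add: s)
  have s_pow: "?s (Q [^]\<^bsub>EG\<^esub> (k::nat)) = ?s Q [^]\<^bsub>EG\<^esub> k" for Q k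
    by (induction k) (simp_all add: EG_simps s)
  have sP: "?s P \<in> torsion_elements EG"
    using n sE s_pow[of P n] by (auto simp: torsion_elements_def EG_simps)
  have "ec_neg (?s P) [^]\<^bsub>EG\<^esub> n = \<one>\<^bsub>EG\<^esub>"
    using EG.nat_pow_inv[of "?s P" n] sE s_pow[of P n] n by (simp add: inv_EG) (simp add: EG_simps inv_EG)
  then have nP: "ec_neg (?s P) \<in> torsion_elements EG"
    using n sE by (auto simp: torsion_elements_def EG_simps)
  \<comment> \<open>Being fixed or negated by conjugation leaves the abscissa unchanged in either
    case, so the abscissa is rational.\<close>
  have fixed_x: "\<exists>i::nat. Q = Affine 2 3 [^]\<^bsub>EG\<^esub> i"
    if Q: "Q \<in> torsion_elements EG" "?s Q = Q \<or> ?s Q = ec_neg Q" for Q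
  proof (cases Q)
    case Infinity
    then show ?thesis using pow_Affine_2_3(1) by metis
  next
    case (Affine x y)
    with Q(2) have "\<sigma> x = x" by auto
    then obtain q where "x = of_rat q" using \<sigma>(4) by blast
    with Q(1) Affine torsion_rational_x_cases show ?thesis by blast
  qed
  have 1: "?s (P \<otimes>\<^bsub>EG\<^esub> ?s P) = P \<otimes>\<^bsub>EG\<^esub> ?s P"
    using PE sE by (simp add: EG_simps s ss ec_add_commute)
  have "?s (P \<otimes>\<^bsub>EG\<^esub> ec_neg (?s P)) = ?s P \<otimes>\<^bsub>EG\<^esub> ec_neg P"
    by (simp add: EG_simps s ss)
  also have "\<dots> = inv\<^bsub>EG\<^esub> (P \<otimes>\<^bsub>EG\<^esub> ec_neg (?s P))"
  proof -
    have c: "P \<in> carrier EG" "?s P \<in> carrier EG" using PE sE by (simp_all add: EG_simps)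
    then have "?s P \<otimes>\<^bsub>EG\<^esub> inv\<^bsub>EG\<^esub> P = inv\<^bsub>EG\<^esub> (P \<otimes>\<^bsub>EG\<^esub> inv\<^bsub>EG\<^esub> (?s P))"
      by (simp add: EG.inv_mult EG.m_comm)
    then show ?thesis by (simp only: inv_EG[OF PE] inv_EG[OF sE])
  qed
  also have "\<dots> = ec_neg (P \<otimes>\<^bsub>EG\<^esub> ec_neg (?s P))"
    using PE sE by (intro inv_EG) (simp add: EG_simps ec_add_in_E)
  finally have 2: "?s (P \<otimes>\<^bsub>EG\<^esub> ec_neg (?s P)) = ec_neg (P \<otimes>\<^bsub>EG\<^esub> ec_neg (?s P))" .
  obtain i j :: nat where i: "P \<otimes>\<^bsub>EG\<^esub> ?s P = Affine 2 3 [^]\<^bsub>EG\<^esub> i"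
    and j: "P \<otimes>\<^bsub>EG\<^esub> ec_neg (?s P) = Affine 2 3 [^]\<^bsub>EG\<^esub> j"
    using fixed_x[OF EG.torsion_elements_mult[OF P sP]] fixed_x[OF EG.torsion_elements_mult[OF P nP]] 1 2
    by blast
  have "P \<otimes>\<^bsub>EG\<^esub> P = (P \<otimes>\<^bsub>EG\<^esub> ?s P) \<otimes>\<^bsub>EG\<^esub> (P \<otimes>\<^bsub>EG\<^esub> inv\<^bsub>EG\<^esub> (?s P))"
  proof -
    have c: "P \<in> carrier EG" "?s P \<in> carrier EG" using PE sE by (simp_all add: EG_simps)
    then have "(P \<otimes>\<^bsub>EG\<^esub> ?s P) \<otimes>\<^bsub>EG\<^esub> (P \<otimes>\<^bsub>EG\<^esub> inv\<^bsub>EG\<^esub> (?s P))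
        = (P \<otimes>\<^bsub>EG\<^esub> P) \<otimes>\<^bsub>EG\<^esub> (?s P \<otimes>\<^bsub>EG\<^esub> inv\<^bsub>EG\<^esub> (?s P))"
      by (simp add: EG.m_ac)
    then show ?thesis using c by simp
  qed
  also have "\<dots> = Affine 2 3 [^]\<^bsub>EG\<^esub> (i + j)"
    unfolding inv_EG[OF sE] i j by (rule EG.nat_pow_mult[OF Affine_2_3_in_EG])
  finally show ?thesis by blast
qed

text \<open>Once \<open>2 P\<close> is an even multiple \<open>2 j A\<close> of
  \<open>A = (2, 3)\<close>, the difference \<open>P - j A\<close> is killed by 2, which means that
  it is \<open>Infinity\<close> or has ordinate 0.\<close>

lemma torsion_decompose:
  assumes K: "quadratic_field TYPE('a::field_char_0)"
    and P: "(P :: 'a ec_point) \<in> torsion_elements EG"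
  obtains j :: nat and Q where "Q \<in> E" "Q = Infinity \<or> (\<exists>x. Q = Affine x 0)"
    "P = Q \<otimes>\<^bsub>EG\<^esub> Affine 2 3 [^]\<^bsub>EG\<^esub> j"
proof -
  let ?A = "Affine 2 3 :: 'a ec_point"
  have PE: "P \<in> carrier EG" using P by (simp add: torsion_elements_def)
  note A = Affine_2_3_in_EG[where 'a = 'a]
  obtain i :: nat where i: "P \<otimes>\<^bsub>EG\<^esub> P = ?A [^]\<^bsub>EG\<^esub> i"
    using torsion_double[OF K P] by blast
  have "even i"
  proof (rule ccontr)
    assume "odd i"
    then obtain k where k: "i = 2 * k + 1" by (rule oddE)
    \<comment> \<open>For odd \<open>i\<close> the double of \<open>3 P\<close> is
      \<open>3 i A = 3 A = (-1, 0)\<close>, because \<open>6 A\<close> vanishes; but this point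
      cannot be halved.\<close>
    define R where "R = P [^]\<^bsub>EG\<^esub> (3::nat)"
    have "R \<otimes>\<^bsub>EG\<^esub> R = (P \<otimes>\<^bsub>EG\<^esub> P) [^]\<^bsub>EG\<^esub> (3::nat)"
      unfolding R_def using PE by (simp add: EG.nat_pow_distrib)
    also have "\<dots> = ?A [^]\<^bsub>EG\<^esub> (i * 3)"
      unfolding i by (rule EG.nat_pow_pow[OF A])
    also have "\<dots> = ?A [^]\<^bsub>EG\<^esub> ((i * 3) mod 6)"
      using EG.nat_pow_mod[OF A, of 6] pow_Affine_2_3(7)[where 'a = 'a] by (simp add: EG_simps)
    also have "(i * 3) mod 6 = 3" unfolding k by presburger
    finally have "ec_add 0 R R = Affine (- 1) 0"
      by (simp only: EG_simps pow_Affine_2_3)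
    moreover have "R \<in> E" using EG.nat_pow_closed[OF PE] by (simp add: R_def EG_simps)
    ultimately show False using ec_add_double_neq[OF K] by blast
  qed
  then obtain j where j: "i = 2 * j" by (rule evenE)
  define B where "B = ?A [^]\<^bsub>EG\<^esub> j"
  have B: "B \<in> carrier EG" unfolding B_def by (rule EG.nat_pow_closed[OF A])
  have "B \<otimes>\<^bsub>EG\<^esub> B = P \<otimes>\<^bsub>EG\<^esub> P"
    unfolding B_def i j using A by (simp add: EG.nat_pow_mult mult_2)
  define Q where "Q = P \<otimes>\<^bsub>EG\<^esub> inv\<^bsub>EG\<^esub> B"
  have Q: "Q \<in> carrier EG" using PE B by (simp add: Q_def)
  have "Q \<otimes>\<^bsub>EG\<^esub> Q = (P \<otimes>\<^bsub>EG\<^esub> P) \<otimes>\<^bsub>EG\<^esub> inv\<^bsub>EG\<^esub> (B \<otimes>\<^bsub>EG\<^esub> B)"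
    using PE B by (simp add: Q_def EG.inv_mult EG.m_ac)
  then have "Q \<otimes>\<^bsub>EG\<^esub> Q = \<one>\<^bsub>EG\<^esub>"
    using PE \<open>B \<otimes>\<^bsub>EG\<^esub> B = P \<otimes>\<^bsub>EG\<^esub> P\<close> by simp
  then have QQ: "ec_add 0 Q Q = Infinity" by (simp add: EG_simps)
  have two: "Q = Infinity \<or> (\<exists>x. Q = Affine x 0)"
  proof (cases Q)
    case (Affine x y)
    with QQ have "y = - y" by (auto simp: Let_def split: if_splits)
    then show ?thesis using Affine by (simp add: eq_neg_iff_add_eq_0)
  qed simp
  have "P = Q \<otimes>\<^bsub>EG\<^esub> B"
    using PE B by (simp add: Q_def EG.m_assoc)
  with two Q that[of Q j] show thesis by (simp add: EG_simps B_def)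
qed

section \<open>The torsion subgroup\<close>

lemma (in comm_group) iso_integer_mod_group_6:
  assumes a: "a \<in> carrier G" "a [^] (6::nat) = \<one>"
    and inj: "inj_on (\<lambda>i::nat. a [^] i) {..<6}"
    and T: "T = range (\<lambda>i::nat. a [^] i)"
  shows "G\<lparr>carrier := T\<rparr> \<cong> integer_mod_group 6"
proof -
  define f where "f i = a [^] nat i" for i :: int
  have "f \<in> iso (integer_mod_group 6) (G\<lparr>carrier := T\<rparr>)"
  proof (rule isoI)
    show "f \<in> hom (integer_mod_group 6) (G\<lparr>carrier := T\<rparr>)"
    proof (rule homI)
      fix i j assume "i \<in> carrier (integer_mod_group 6)" "j \<in> carrier (integer_mod_group 6)"
      then have ij: "i \<ge> 0" "j \<ge> 0" by (auto simp: carrier_integer_mod_group)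
      have "f ((i + j) mod 6) = a [^] ((nat i + nat j) mod 6)"
        using ij by (simp add: f_def nat_mod_distrib nat_add_distrib)
      also have "\<dots> = a [^] nat i \<otimes> a [^] nat j"
        using a by (simp add: nat_pow_mod nat_pow_mult)
      finally show "f (i \<otimes>\<^bsub>integer_mod_group 6\<^esub> j) = f i \<otimes>\<^bsub>G\<lparr>carrier := T\<rparr>\<^esub> f j"
        by (simp add: f_def)
    qed (simp add: f_def T)
    show "bij_betw f (carrier (integer_mod_group 6)) (carrier (G\<lparr>carrier := T\<rparr>))"
      unfolding bij_betw_def
    proof
      show "inj_on f (carrier (integer_mod_group 6))"
      proof (rule inj_onI)
        fix i j assume "i \<in> carrier (integer_mod_group 6)" "j \<in> carrier (integer_mod_group 6)" "f i = f j"
        then have "nat i = nat j" "i \<ge> 0" "j \<ge> 0"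
          using inj_onD[OF inj, of "nat i" "nat j"] by (auto simp: carrier_integer_mod_group f_def)
        then show "i = j" by simp
      qed
      have "a [^] k \<in> f ` carrier (integer_mod_group 6)" for k :: nat
      proof
        show "a [^] k = f (int (k mod 6))" using a by (simp add: f_def nat_pow_mod)
      qed (simp add: carrier_integer_mod_group)
      then show "f ` carrier (integer_mod_group 6) = carrier (G\<lparr>carrier := T\<rparr>)"
        by (auto simp: T f_def)
    qed
  qed
  then have "integer_mod_group 6 \<cong> G\<lparr>carrier := T\<rparr>" by (rule is_isoI)
  then show ?thesis by (rule group.iso_sym[OF group_integer_mod_group])
qed

text \<open>The map is \<open>(i, j) -> b^i a^j\<close>. It is injective because the powers of
  \<open>b\<close> and of \<open>a\<close> meet only in the identity.\<close>

lemma (in comm_group) iso_integer_mod_group_2_6: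
  assumes a: "a \<in> carrier G" "a [^] (6::nat) = \<one>" and b: "b \<in> carrier G" "b [^] (2::nat) = \<one>"
    and inj: "inj_on (\<lambda>i::nat. a [^] i) {..<6}" and ab: "b \<notin> range (\<lambda>i::nat. a [^] i)"
    and T: "T = {b [^] i \<otimes> a [^] j | (i::nat) (j::nat). True}"
  shows "G\<lparr>carrier := T\<rparr> \<cong> integer_mod_group 2 \<times>\<times> integer_mod_group 6"
proof -
  define f where "f = (\<lambda>(i::int, j::int). b [^] nat i \<otimes> a [^] nat j)"
  have car: "carrier (integer_mod_group 2 \<times>\<times> integer_mod_group 6) = {0..<2} \<times> {0..<6}"
    by (simp add: carrier_integer_mod_group DirProd_def)
  have "f \<in> iso (integer_mod_group 2 \<times>\<times> integer_mod_group 6) (G\<lparr>carrier := T\<rparr>)"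
  proof (rule isoI)
    show "f \<in> hom (integer_mod_group 2 \<times>\<times> integer_mod_group 6) (G\<lparr>carrier := T\<rparr>)"
    proof (rule homI)
      fix u v assume "u \<in> carrier (integer_mod_group 2 \<times>\<times> integer_mod_group 6)"
        "v \<in> carrier (integer_mod_group 2 \<times>\<times> integer_mod_group 6)"
      then have "u \<in> {0..<2} \<times> {0..<6}" "v \<in> {0..<2} \<times> {0..<6}" by (simp_all only: car)
      then obtain i j k l where u: "u = (i, j)" and v: "v = (k, l)"
        and nn: "i \<ge> 0" "j \<ge> 0" "k \<ge> 0" "l \<ge> 0" by auto
      have "b [^] nat ((i + k) mod 2) = b [^] ((nat i + nat k) mod 2)"
        using nn by (simp add: nat_mod_distrib nat_add_distrib)
      also have "\<dots> = b [^] nat i \<otimes> b [^] nat k"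
        using b by (simp add: nat_pow_mod nat_pow_mult)
      finally have 1: "b [^] nat ((i + k) mod 2) = b [^] nat i \<otimes> b [^] nat k" .
      have "a [^] nat ((j + l) mod 6) = a [^] ((nat j + nat l) mod 6)"
        using nn by (simp add: nat_mod_distrib nat_add_distrib)
      also have "\<dots> = a [^] nat j \<otimes> a [^] nat l"
        using a by (simp add: nat_pow_mod nat_pow_mult)
      finally have 2: "a [^] nat ((j + l) mod 6) = a [^] nat j \<otimes> a [^] nat l" .
      show "f (u \<otimes>\<^bsub>integer_mod_group 2 \<times>\<times> integer_mod_group 6\<^esub> v) = f u \<otimes>\<^bsub>G\<lparr>carrier := T\<rparr>\<^esub> f v"
        using a b by (simp add: f_def u v 1 2 m_ac)
    qed (auto simp: f_def T)
    show "bij_betw f (carrier (integer_mod_group 2 \<times>\<times> integer_mod_group 6)) (carrier (G\<lparr>carrier := T\<rparr>))"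
      unfolding bij_betw_def car
    proof
      \<comment> \<open>Multiplying an equality by the inverse \<open>a [^] (6 - j)\<close> would
        exhibit \<open>b\<close> as a power of \<open>a\<close>; \<open>j < 6\<close> keeps the
        natural subtraction exact.\<close>
      have mixed: "b [^] (1::nat) \<otimes> a [^] j \<noteq> b [^] (0::nat) \<otimes> a [^] l" if "j < 6" for j l :: nat
      proof
        assume "b [^] (1::nat) \<otimes> a [^] j = b [^] (0::nat) \<otimes> a [^] l"
        then have eq: "b \<otimes> a [^] j = a [^] l" using a b by simp
        have "b = b \<otimes> (a [^] j \<otimes> a [^] (6 - j))"
          using that a b by (simp add: nat_pow_mult)
        also have "\<dots> = a [^] l \<otimes> a [^] (6 - j)"
          using a(1) b(1) by (simp only: m_assoc[symmetric] nat_pow_closed eq)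
        also have "\<dots> = a [^] (l + (6 - j))"
          using a(1) by (rule nat_pow_mult)
        finally show False using ab by blast
      qed
      show "inj_on f ({0..<2} \<times> {0..<6})"
      proof (rule inj_onI)
        fix u v assume "u \<in> {0..<2} \<times> {0..<6::int}" "v \<in> {0..<2} \<times> {0..<6::int}" and fuv: "f u = f v"
        then obtain i j k l where u: "u = (i, j)" and v: "v = (k, l)"
          and r: "i \<in> {0..<2}" "k \<in> {0..<2}" "j \<in> {0..<6}" "l \<in> {0..<6}" by auto
        have eq: "b [^] nat i \<otimes> a [^] nat j = b [^] nat k \<otimes> a [^] nat l"
          using fuv by (simp add: f_def u v)
        have lt: "nat j < 6" "nat l < 6" using r by auto
        have cases: "i = 0 \<or> i = 1" "k = 0 \<or> k = 1" using r by auto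
        have "i = k"
          using cases eq mixed[OF lt(1), of "nat l"] mixed[OF lt(2), of "nat j"] by auto
        with eq have "a [^] nat j = a [^] nat l" using a b by simp
        with inj lt have "nat j = nat l" by (auto dest: inj_onD)
        with r \<open>i = k\<close> show "u = v" by (auto simp: u v)
      qed
      have "b [^] i \<otimes> a [^] j \<in> f ` ({0..<2} \<times> {0..<6})" for i j :: nat
      proof
        show "b [^] i \<otimes> a [^] j = f (int (i mod 2), int (j mod 6))"
          using a b by (simp add: f_def nat_pow_mod)
      qed simp
      then show "f ` ({0..<2} \<times> {0..<6}) = carrier (G\<lparr>carrier := T\<rparr>)"
        by (auto simp: T f_def)
    qed
  qed
  then have "integer_mod_group 2 \<times>\<times> integer_mod_group 6 \<cong> G\<lparr>carrier := T\<rparr>" by (rule is_isoI)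
  then show ?thesis
    by (rule group.iso_sym[OF DirProd_group[OF group_integer_mod_group group_integer_mod_group]])
qed

lemma inj_on_pow_Affine_2_3:
  "inj_on (\<lambda>i::nat. (Affine 2 3 :: 'a::field_char_0 ec_point) [^]\<^bsub>EG\<^esub> i) {..<6}"
proof -
  have neq: "(3::'a) \<noteq> - 3" "(1::'a) \<noteq> - 1" "(2::'a) \<noteq> - 1" by (simp_all add: eq_neg_iff_add_eq_0)
  have six: "{..<6} = {0, 1, 2, 3, 4, 5 :: nat}" by auto
  show ?thesis
    unfolding six inj_on_insert using neq
    by (simp add: pow_Affine_2_3[where 'a = 'a] pow_Affine_2_3(2)[where 'a = 'a, unfolded One_nat_def] EG_simps(3)
        del: EG.nat_pow_Suc nat_pow_Suc)
qed

theorem corollary3: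
  assumes "quadratic_field TYPE('a::field_char_0)"
  shows "torsion_subgroup (ec_group (0::'a) 1) \<cong> integer_mod_group 6
       \<or> torsion_subgroup (ec_group (0::'a) 1) \<cong> integer_mod_group 18
       \<or> torsion_subgroup (ec_group (0::'a) 1) \<cong> integer_mod_group 2 \<times>\<times> integer_mod_group 6"
proof -
  let ?T = "torsion_elements (EG :: 'a ec_point monoid)"
  let ?A = "Affine 2 3 :: 'a ec_point"
  note A = Affine_2_3_in_EG[where 'a = 'a]
  have A6: "?A [^]\<^bsub>EG\<^esub> (6::nat) = \<one>\<^bsub>EG\<^esub>"
    unfolding pow_Affine_2_3(7) by (simp add: EG_simps)
  have A_tors: "?A [^]\<^bsub>EG\<^esub> i \<in> ?T" for i :: nat
  proof -
    have "(?A [^]\<^bsub>EG\<^esub> i) [^]\<^bsub>EG\<^esub> (6::nat) = (?A [^]\<^bsub>EG\<^esub> (6::nat)) [^]\<^bsub>EG\<^esub> i"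
      using A by (simp only: EG.nat_pow_pow mult.commute)
    then have "(?A [^]\<^bsub>EG\<^esub> i) [^]\<^bsub>EG\<^esub> (6::nat) = \<one>\<^bsub>EG\<^esub>" by (simp only: A6 EG.nat_pow_one)
    with A show ?thesis
      unfolding torsion_elements_def by (auto intro!: exI[of _ "6::nat"])
  qed
  have cube: "x = - 1 \<or> x ^ 2 - x + 1 = 0" if "Affine x 0 \<in> E" for x :: 'a
  proof -
    have "(x + 1) * (x ^ 2 - x + 1) = 0"
      using that by (simp add: algebra_simps power2_eq_square power3_eq_cube)
    then show ?thesis by (auto simp: add_eq_0_iff2)
  qed
  show ?thesis
  \<comment> \<open>The cofactor of \<open>x + 1\<close> in \<open>x ^ 3 + 1\<close> decides whether
    there is 2-torsion beyond \<open>(-1, 0)\<close>; a root is a primitive sixth root of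
    unity.\<close>
  proof (cases "\<exists>\<omega>::'a. \<omega> ^ 2 - \<omega> + 1 = 0")
    case False
    have "?T = range (\<lambda>i::nat. ?A [^]\<^bsub>EG\<^esub> i)"
    proof (intro equalityI subsetI)
      fix P assume "P \<in> ?T"
      then obtain j :: nat and Q where Q: "Q \<in> E" "Q = Infinity \<or> (\<exists>x. Q = Affine x 0)"
        and P: "P = Q \<otimes>\<^bsub>EG\<^esub> ?A [^]\<^bsub>EG\<^esub> j"
        using torsion_decompose[OF assms] by blast
      have "Q = ?A [^]\<^bsub>EG\<^esub> (0::nat) \<or> Q = ?A [^]\<^bsub>EG\<^esub> (3::nat)"
        using Q cube False unfolding pow_Affine_2_3 by blast
      then obtain i :: nat where "Q = ?A [^]\<^bsub>EG\<^esub> i" by blast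
      then have "P = ?A [^]\<^bsub>EG\<^esub> (i + j)" using P A by (simp only: EG.nat_pow_mult)
      then show "P \<in> range (\<lambda>i::nat. ?A [^]\<^bsub>EG\<^esub> i)" by blast
    qed (use A_tors in blast)
    from EG.iso_integer_mod_group_6[OF A A6 inj_on_pow_Affine_2_3 this]
    show ?thesis unfolding torsion_subgroup_def by blast
  next
    case True
    then obtain \<omega> :: 'a where \<omega>: "\<omega> ^ 2 - \<omega> + 1 = 0" by blast
    let ?B = "Affine \<omega> 0"
    have "\<omega> ^ 3 = - 1" using \<omega> by algebra
    then have B: "?B \<in> carrier EG" by (simp add: EG_simps)
    have BB: "ec_add 0 ?B ?B = Infinity" by simp
    have B2: "?B [^]\<^bsub>EG\<^esub> (2::nat) = \<one>\<^bsub>EG\<^esub>"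
      using EG.nat_pow_mult[OF B, of 1 1] B by (simp add: EG_simps numeral_2_eq_2)
    have \<omega>1: "\<omega> \<noteq> - 1" using \<omega> by auto
    have B_notin: "?B \<notin> range (\<lambda>i::nat. ?A [^]\<^bsub>EG\<^esub> i)"
    proof
      assume "?B \<in> range (\<lambda>i::nat. ?A [^]\<^bsub>EG\<^esub> i)"
      then obtain i :: nat where "?B = ?A [^]\<^bsub>EG\<^esub> (i mod 6)"
        using EG.nat_pow_mod[OF A A6] by auto
      moreover have "i mod 6 \<in> {0, 1, 2, 3, 4, 5}" by (simp, presburger)
      ultimately show False
        using \<omega>1 pow_Affine_2_3[where 'a = 'a] by auto
    qed
    let ?S = "{?B [^]\<^bsub>EG\<^esub> i \<otimes>\<^bsub>EG\<^esub> ?A [^]\<^bsub>EG\<^esub> j | (i::nat) (j::nat). True}"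
    have "?T = ?S"
    proof (intro equalityI subsetI)
      fix P assume "P \<in> ?T"
      then obtain j :: nat and Q where Q: "Q \<in> E" "Q = Infinity \<or> (\<exists>x. Q = Affine x 0)"
        and P: "P = Q \<otimes>\<^bsub>EG\<^esub> ?A [^]\<^bsub>EG\<^esub> j"
        using torsion_decompose[OF assms] by blast
      \<comment> \<open>The remaining point of order 2 belongs to the other root
        \<open>1 - \<omega>\<close> and equals \<open>B + 3 A\<close>.\<close>
      have third: "ec_add 0 ?B (Affine (- 1) 0) = Affine (1 - \<omega>) 0"
        using \<omega>1 by (simp add: Let_def)
      have "Q = Infinity \<or> Q = Affine (- 1) 0 \<or> Q = ?B \<or> Q = Affine (1 - \<omega>) 0"
      proof -
        have "x = \<omega> \<or> x = 1 - \<omega>" if "x ^ 2 - x + 1 = 0" for x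
        proof -
          have "(x - \<omega>) * (x - (1 - \<omega>)) = 0" using that \<omega> by algebra
          then show ?thesis by auto
        qed
        with Q cube show ?thesis by blast
      qed
      then have "\<exists>(i::nat) (k::nat). Q = ?B [^]\<^bsub>EG\<^esub> i \<otimes>\<^bsub>EG\<^esub> ?A [^]\<^bsub>EG\<^esub> k"
      proof (elim disjE)
        assume "Q = Infinity"
        then have "Q = ?B [^]\<^bsub>EG\<^esub> (0::nat) \<otimes>\<^bsub>EG\<^esub> ?A [^]\<^bsub>EG\<^esub> (0::nat)"
          by (simp add: EG_simps)
        then show ?thesis by blast
      next
        assume "Q = Affine (- 1) 0"
        then have "Q = ?B [^]\<^bsub>EG\<^esub> (0::nat) \<otimes>\<^bsub>EG\<^esub> ?A [^]\<^bsub>EG\<^esub> (3::nat)"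
          unfolding pow_Affine_2_3 by (simp add: EG_simps)
        then show ?thesis by blast
      next
        assume "Q = ?B"
        then have "Q = ?B [^]\<^bsub>EG\<^esub> (1::nat) \<otimes>\<^bsub>EG\<^esub> ?A [^]\<^bsub>EG\<^esub> (0::nat)"
          using B by simp
        then show ?thesis by blast
      next
        assume "Q = Affine (1 - \<omega>) 0"
        then have "Q = ?B [^]\<^bsub>EG\<^esub> (1::nat) \<otimes>\<^bsub>EG\<^esub> ?A [^]\<^bsub>EG\<^esub> (3::nat)"
          using B third unfolding pow_Affine_2_3 by (simp add: EG_simps(2,3))
        then show ?thesis by blast
      qed
      then obtain i k :: nat where "Q = ?B [^]\<^bsub>EG\<^esub> i \<otimes>\<^bsub>EG\<^esub> ?A [^]\<^bsub>EG\<^esub> k" by blast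
      then have "P = ?B [^]\<^bsub>EG\<^esub> i \<otimes>\<^bsub>EG\<^esub> ?A [^]\<^bsub>EG\<^esub> (k + j)"
        using A B by (simp add: P EG.m_assoc EG.nat_pow_mult)
      then show "P \<in> ?S" by blast
    next
      fix P assume "P \<in> ?S"
      moreover have "?B [^]\<^bsub>EG\<^esub> i \<in> ?T" for i :: nat
      proof -
        have "(?B [^]\<^bsub>EG\<^esub> i) [^]\<^bsub>EG\<^esub> (2::nat) = (?B [^]\<^bsub>EG\<^esub> (2::nat)) [^]\<^bsub>EG\<^esub> i"
          using B by (simp only: EG.nat_pow_pow mult.commute)
        then have "(?B [^]\<^bsub>EG\<^esub> i) [^]\<^bsub>EG\<^esub> (2::nat) = \<one>\<^bsub>EG\<^esub>" by (simp only: B2 EG.nat_pow_one)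
        with B show ?thesis
          unfolding torsion_elements_def by (auto intro!: exI[of _ "2::nat"])
      qed
      ultimately show "P \<in> ?T" using A_tors EG.torsion_elements_mult by blast
    qed
    from EG.iso_integer_mod_group_2_6[OF A A6 B B2 inj_on_pow_Affine_2_3 B_notin this]
    show ?thesis unfolding torsion_subgroup_def by blast
  qed
qed

end
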